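(* Let $v_1,\dots,v_m:B\setminus\{0\}\to\mathbb Z$ be valuations over $K$ and let $f_1,\dots,f_k\in A$ be (non-zero) $\Delta$-homogeneous generators of $A$ as a $K$-algebra. The MUVAK basis algorithm (described in the context) with input $f_1,\dots,f_k$ and $v_1,\dots,v_m$ terminates after finitely many steps if and only if there exists a finite $\Delta$-homogeneous MUVAK basis of $A$ with respect to $v_1,\dots,v_m$. If the algorithm terminates, its output is such a basis.
   Context: $K$ is a field; $A\le B$ are finitely generated commutative $K$-algebras and domains ($A$ a $K$-subalgebra of $B$); $A$ is graded by a finitely generated abelian group $\Delta$ with degree function $\deg_\Delta$. A valuation over $K$ is a map $v:B\setminus\{0\}\to\mathbb Z$ with $v(f+g)\ge\min\{v(f),v(g)\}$ whenever $f,g,f+g\ne0$; $v(fg)=v(f)+v(g)$ for $f,g\ne0$; $v(\lambda f)=v(f)$ for $0\ne\lambda\in K$, $f\ne0$. Convention: $v(0)=\infty$. For $\gamma\in\mathbb Z$ let $F_{v\ge\gamma}=\{f\in B\setminus\{0\}\mid v(f)\ge\gamma\}\cup\{0\}$, similarly $F_{v>\gamma}$, and $\operatorname{gr}_v(B)=\bigoplus_\gamma F_{v\ge\gamma}/F_{v>\gamma}$. For $0\neq f\in B$ with $v(f)=\gamma$, $\operatorname{in}_v(f)$ is the class of $f$ in $F_{v\ge\gamma}/F_{v>\gamma}$. For $\Delta$-homogeneous $0\ne f\in A$ of degree $\delta$, $\operatorname{in}_v^\Delta(f)=\operatorname{in}_v(f)\otimes\delta\in\operatorname{gr}_v(B)\otimes_KK\Delta$,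 where $K\Delta$ is the group ring; $\operatorname{in}_v^\Delta(A)$ is the $K$-subalgebra generated by all these. For a polynomial $h$, $\operatorname{Supp}(h)$ is the set of its non-zero terms. A $\Delta$-homogeneous $f\in A$ is faithfully representable in $\Delta$-homogeneous $f_1,\dots,f_k\in A$ with respect to $v_1,\dots,v_m$ if there is $h\in K[X_1,\dots,X_k]$ with $h(f_1,\dots,f_k)=f$ and $v_i(t(f_1,\dots,f_k))\ge v_i(f)$ for all $t\in\operatorname{Supp}(h)$ and all $i$. A set $\mathcal G\subseteq A$ of $\Delta$-homogeneous $K$-algebra generators of $A$ is a $\Delta$-homogeneous MUVAK basis of $A$ with respect to $v_1,\dots,v_m$ if for every $\Delta$-homogeneous $f\in A$ there are $f_1,\dots,f_k\in\mathcal G$ such that $f$ is faithfully representable in $f_1,\dots,f_k$ with respect to $v_1,\dots,v_m$. Ideals attached to a finite set $\mathcal G=\{f_1,\dots,f_l\}$ of non-zero $\Delta$-homogeneous generators of $A$: let $R=K[X_1,\dots,X_l]$, $\deg_\Delta(X_j)=\deg_\Delta(f_j)$, and for $1\le i\le m$ let $\deg_i$ be the $\mathbb Z$-grading of $R$ with $\deg_i(X_j)=v_i(f_j)$. Let $\alpha:R\to A$, $X_j\mapsto f_j$, and $\beta_i:R\to\operatorname{in}_{v_i}^\Delta(A)$, $X_j\mapsto\operatorname{in}_{v_i}^\Delta(f_j)$; put $I=\ker\alpha$, $J_i=\ker\beta_i$. For $0\ne h=\sum_a h_a\in R$ with terms $h_a$, let $\mu_i=\min_a\deg_i(h_a)$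 and define the negative homogenization $h^{\mathrm{hom}}=\sum_ah_a\prod_{i=1}^mt_i^{\deg_i(h_a)-\mu_i}\in R[t_1,\dots,t_m]$; $0^{\mathrm{hom}}=0$. The gradings extend by $\deg_i(t_j)=-1$ if $i=j$ and $0$ otherwise, and $\deg_\Delta(t_j)=0$. For an ideal $\mathfrak a$ of $R$, $\mathfrak a^{\mathrm{hom}}=\langle h^{\mathrm{hom}}\mid h\in\mathfrak a\rangle\subseteq R[t_1,\dots,t_m]$. For $h\in R[t_1,\dots,t_m]$, $h^{\mathrm{deh}}\in R$ is obtained by setting all $t_j=1$. MUVAK basis algorithm. Input: $\Delta$-homogeneous generators $f_1,\dots,f_k$ of $A$ and valuations $v_1,\dots,v_m:B\setminus\{0\}\to\mathbb Z$ over $K$. Initialize $\mathcal G=\{f_1,\dots,f_k\}$. All ideals $I^{\mathrm{hom}},J_i^{\mathrm{hom}}$ below are those attached to the current $\mathcal G$ (they are updated whenever $\mathcal G$ changes). While $J_i^{\mathrm{hom}}\not\subseteq I^{\mathrm{hom}}+\langle t_i\rangle$ for some $i\in\{1,\dots,m\}$: for $i=1,\dots,m$ successively, write $\mathcal G=\{f_1,\dots,f_l\}$ and $J_i^{\mathrm{hom}}=\langle h_1,\dots,h_r\rangle$ with finitely many generators $h_j$ that are homogeneous with respect to $\Delta$ and all of $\deg_1,\dots,\deg_m$, and replace $\mathcal G$ by $\mathcal G\cup\{h_j^{\mathrm{deh}}(f_1,\dots,f_l)\mid 1\le j\le r,\ h_j\notin I^{\mathrm{hom}}+\langle t_i\rangle\}$.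 When the while-loop ends, return $\mathcal G$. *)

theory Defs
  imports
    Complex_Main
    "HOL-Library.Poly_Mapping"
    "HOL-Library.Extended"
    "HOL-Library.Set_Algebras"
    "HOL-Computational_Algebra.Group_Closure"
    "HOL-Algebra.QuotRing"
begin

section \<open>Algebras, gradings, valuations\<close>

text \<open>
  The domain \<open>B\<close> is a type \<open>'b\<close> of class \<open>idom\<close>; \<open>scale\<close> is its scalar multiplication over the
  field \<open>'k\<close>. The algebra \<open>A\<close> is a subset of \<open>'b\<close>.
\<close>

locale comm_algebra = vector_space scale
  for scale :: "'k::field \<Rightarrow> 'b::idom \<Rightarrow> 'b" +
  assumes scale_mult_left: "scale c (x * y) = scale c x * y"

definition subalg :: "('k::field \<Rightarrow> 'b::idom \<Rightarrow> 'b) \<Rightarrow> 'b set \<Rightarrow> bool" where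
  "subalg scale S \<longleftrightarrow>
     module.subspace scale S \<and> 1 \<in> S \<and> (\<forall>x\<in>S. \<forall>y\<in>S. x * y \<in> S)"

abbreviation generated_alg :: "('k::field \<Rightarrow> 'b::idom \<Rightarrow> 'b) \<Rightarrow> 'b set \<Rightarrow> 'b set" where
  "generated_alg scale S \<equiv> subalg scale hull S"

definition fin_gen_alg :: "('k::field \<Rightarrow> 'b::idom \<Rightarrow> 'b) \<Rightarrow> 'b set \<Rightarrow> bool" where
  "fin_gen_alg scale S \<longleftrightarrow> subalg scale S \<and> (\<exists>F. finite F \<and> generated_alg scale F = S)"

text \<open>\<open>Agr \<delta>\<close> is the homogeneous component of degree \<open>\<delta>\<close>; it contains \<open>0\<close>.\<close>

definition graded_alg ::
  "('k::field \<Rightarrow> 'b::idom \<Rightarrow> 'b) \<Rightarrow> 'b set \<Rightarrow> ('d::ab_group_add \<Rightarrow> 'b set) \<Rightarrow> bool" where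
  "graded_alg scale A Agr \<longleftrightarrow>
     (\<forall>\<delta>. module.subspace scale (Agr \<delta>) \<and> Agr \<delta> \<subseteq> A) \<and>
     1 \<in> Agr 0 \<and>
     (\<forall>\<delta> \<epsilon>. \<forall>x\<in>Agr \<delta>. \<forall>y\<in>Agr \<epsilon>. x * y \<in> Agr (\<delta> + \<epsilon>)) \<and>
     (\<forall>x\<in>A. \<exists>!c :: 'd \<Rightarrow>\<^sub>0 'b.
        (\<forall>\<delta>. Poly_Mapping.lookup c \<delta> \<in> Agr \<delta>) \<and> x = (\<Sum>\<delta>\<in>Poly_Mapping.keys c. Poly_Mapping.lookup c \<delta>))"

definition homogeneous_elem :: "('d \<Rightarrow> 'b set) \<Rightarrow> 'b \<Rightarrow> bool" where
  "homogeneous_elem Agr f \<longleftrightarrow> (\<exists>\<delta>. f \<in> Agr \<delta>)"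

definition degree_elem :: "('d \<Rightarrow> 'b set) \<Rightarrow> 'b \<Rightarrow> 'd" where
  "degree_elem Agr f = (THE \<delta>. f \<in> Agr \<delta>)"

text \<open>
  A valuation is a function on \<open>B - {0}\<close>; the value of \<open>v\<close> at \<open>0\<close> is irrelevant everywhere below,
  and \<open>ext_val v\<close> is the extension of \<open>v\<close> with \<open>v 0 = \<infinity>\<close>.
\<close>

definition valuation :: "('k::field \<Rightarrow> 'b::idom \<Rightarrow> 'b) \<Rightarrow> ('b \<Rightarrow> int) \<Rightarrow> bool" where
  "valuation scale v \<longleftrightarrow>
     (\<forall>f g. f \<noteq> 0 \<and> g \<noteq> 0 \<and> f + g \<noteq> 0 \<longrightarrow> v (f + g) \<ge> min (v f) (v g)) \<and>
     (\<forall>f g. f \<noteq> 0 \<and> g \<noteq> 0 \<longrightarrow> v (f * g) = v f + v g) \<and>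
     (\<forall>c f. c \<noteq> 0 \<and> f \<noteq> 0 \<longrightarrow> v (scale c f) = v f)"

definition ext_val :: "('b::zero \<Rightarrow> int) \<Rightarrow> 'b \<Rightarrow> int extended" where
  "ext_val v f = (if f = 0 then Pinf else Fin (v f))"

section \<open>The associated graded ring and the initial forms of homogeneous elements\<close>

definition F_ge :: "('b::zero \<Rightarrow> int) \<Rightarrow> int \<Rightarrow> 'b set" where
  "F_ge v \<gamma> = {f. f \<noteq> 0 \<and> v f \<ge> \<gamma>} \<union> {0}"

definition F_gt :: "('b::zero \<Rightarrow> int) \<Rightarrow> int \<Rightarrow> 'b set" where
  "F_gt v \<gamma> = {f. f \<noteq> 0 \<and> v f > \<gamma>} \<union> {0}"

text \<open>
  Elements of the direct sum of the quotients \<open>F_ge v \<gamma> / F_gt v \<gamma>\<close> are families of cosets almost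
  all of which are zero, i.e. equal to \<open>F_gt v \<gamma>\<close>. Sums and products of cosets are those of
  \<^theory>\<open>HOL-Library.Set_Algebras\<close>; the elementwise product of a coset in degree \<open>\<epsilon>\<close> and one in degree
  \<open>\<gamma> - \<epsilon>\<close> lies in a single coset modulo \<open>F_gt v \<gamma>\<close>, and adding \<open>F_gt v \<gamma>\<close> yields that coset.
\<close>

definition gr_ring :: "('b::comm_ring_1 \<Rightarrow> int) \<Rightarrow> (int \<Rightarrow> 'b set) ring" where
  "gr_ring v =
     \<lparr>carrier = {x. (\<forall>\<gamma>. \<exists>f\<in>F_ge v \<gamma>. x \<gamma> = f +o F_gt v \<gamma>) \<and> finite {\<gamma>. x \<gamma> \<noteq> F_gt v \<gamma>}},
      monoid.mult = (\<lambda>x y \<gamma>. F_gt v \<gamma> + (\<Sum>\<epsilon> | x \<epsilon> \<noteq> F_gt v \<epsilon>. x \<epsilon> * y (\<gamma> - \<epsilon>))),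
      one = (\<lambda>\<gamma>. if \<gamma> = 0 then 1 +o F_gt v \<gamma> else F_gt v \<gamma>),
      zero = (\<lambda>\<gamma>. F_gt v \<gamma>),
      add = (\<lambda>x y \<gamma>. x \<gamma> + y \<gamma>)\<rparr>"

text \<open>The class of \<open>f \<in> F_ge v \<gamma>\<close> in degree \<open>\<gamma>\<close>.\<close>

definition gr_class :: "('b::comm_ring_1 \<Rightarrow> int) \<Rightarrow> int \<Rightarrow> 'b \<Rightarrow> int \<Rightarrow> 'b set" where
  "gr_class v \<gamma> f = (\<lambda>\<epsilon>. if \<epsilon> = \<gamma> then f +o F_gt v \<gamma> else F_gt v \<epsilon>)"

definition initial_form :: "('b::comm_ring_1 \<Rightarrow> int) \<Rightarrow> 'b \<Rightarrow> int \<Rightarrow> 'b set" where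
  "initial_form v f = gr_class v (v f) f"

text \<open>
  For a \<open>K\<close>-algebra \<open>S\<close>, the tensor product of \<open>S\<close> with the group ring of \<open>\<Delta>\<close> over \<open>K\<close> is realized
  as the group ring of \<open>\<Delta>\<close> over \<open>S\<close>: the direct sum of the \<open>S \<otimes> \<delta>\<close>, with
  \<open>(s \<otimes> \<delta>) (s' \<otimes> \<delta>') = s s' \<otimes> (\<delta> + \<delta>')\<close>.
\<close>

definition group_ring :: "('a, 'm) ring_scheme \<Rightarrow> ('d::ab_group_add \<Rightarrow> 'a) ring" where
  "group_ring S =
     \<lparr>carrier = {x. (\<forall>\<delta>. x \<delta> \<in> carrier S) \<and> finite {\<delta>. x \<delta> \<noteq> \<zero>\<^bsub>S\<^esub>}},
      monoid.mult = (\<lambda>x y \<delta>. \<Oplus>\<^bsub>S\<^esub>\<epsilon>\<in>{\<epsilon>. x \<epsilon> \<noteq> \<zero>\<^bsub>S\<^esub>}. x \<epsilon> \<otimes>\<^bsub>S\<^esub> y (\<delta> - \<epsilon>)),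
      one = (\<lambda>\<delta>. if \<delta> = 0 then \<one>\<^bsub>S\<^esub> else \<zero>\<^bsub>S\<^esub>),
      zero = (\<lambda>\<delta>. \<zero>\<^bsub>S\<^esub>),
      add = (\<lambda>x y \<delta>. x \<delta> \<oplus>\<^bsub>S\<^esub> y \<delta>)\<rparr>"

definition pure_tensor :: "('a, 'm) ring_scheme \<Rightarrow> 'a \<Rightarrow> 'd \<Rightarrow> 'd \<Rightarrow> 'a" where
  "pure_tensor S s \<delta> = (\<lambda>\<epsilon>. if \<epsilon> = \<delta> then s else \<zero>\<^bsub>S\<^esub>)"

definition gr_group_ring ::
  "('b::comm_ring_1 \<Rightarrow> int) \<Rightarrow> ('d::ab_group_add \<Rightarrow> int \<Rightarrow> 'b set) ring" where
  "gr_group_ring v = group_ring (gr_ring v)"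

definition initial_form_Delta ::
  "('d \<Rightarrow> 'b set) \<Rightarrow> ('b::comm_ring_1 \<Rightarrow> int) \<Rightarrow> 'b \<Rightarrow> 'd \<Rightarrow> int \<Rightarrow> 'b set" where
  "initial_form_Delta Agr v f = pure_tensor (gr_ring v) (initial_form v f) (degree_elem Agr f)"

section \<open>Polynomials\<close>

text \<open>
  \<open>Xv j\<close> and \<open>Tv i\<close> are the variables \<open>X\<^sub>j\<close> and \<open>t\<^sub>i\<close>, with indices starting at \<open>0\<close>. The polynomial
  ring in a set \<open>V\<close> of variables is a subring of the ring of polynomials in all variables.
\<close>

datatype mvar = Xv nat | Tv nat

type_synonym 'k mpoly = "(mvar \<Rightarrow>\<^sub>0 nat) \<Rightarrow>\<^sub>0 'k"

definition poly_ring :: "mvar set \<Rightarrow> 'k::comm_ring_1 mpoly ring" where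
  "poly_ring V =
     \<lparr>carrier = {h. \<forall>a\<in>Poly_Mapping.keys h. Poly_Mapping.keys a \<subseteq> V},
      monoid.mult = (*), one = 1, zero = 0, add = (+)\<rparr>"

abbreviation X_ring :: "nat \<Rightarrow> 'k::comm_ring_1 mpoly ring" where
  "X_ring l \<equiv> poly_ring (Xv ` {..<l})"

abbreviation XT_ring :: "nat \<Rightarrow> nat \<Rightarrow> 'k::comm_ring_1 mpoly ring" where
  "XT_ring l m \<equiv> poly_ring (Xv ` {..<l} \<union> Tv ` {..<m})"

definition Var :: "mvar \<Rightarrow> 'k::comm_ring_1 mpoly" where
  "Var x = Poly_Mapping.single (Poly_Mapping.single x 1) 1"

definition Const :: "'k::comm_ring_1 \<Rightarrow> 'k mpoly" where
  "Const c = Poly_Mapping.single 0 c"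

definition Supp :: "'k::comm_ring_1 mpoly \<Rightarrow> 'k mpoly set" where
  "Supp h = (\<lambda>a. Poly_Mapping.single a (Poly_Mapping.lookup h a)) ` Poly_Mapping.keys h"

text \<open>Substitution of \<open>\<sigma> x\<close> for each variable \<open>x\<close>, with values in the algebra given by \<open>scale\<close>.\<close>

definition subst_poly ::
  "('k::comm_ring_1 \<Rightarrow> 'c \<Rightarrow> 'c) \<Rightarrow> (mvar \<Rightarrow> 'c::comm_ring_1) \<Rightarrow> 'k mpoly \<Rightarrow> 'c" where
  "subst_poly scale \<sigma> h =
     (\<Sum>a\<in>Poly_Mapping.keys h.
        scale (Poly_Mapping.lookup h a) (\<Prod>x\<in>Poly_Mapping.keys a. \<sigma> x ^ Poly_Mapping.lookup a x))"

text \<open>\<open>h(f\<^sub>1, \<dots>, f\<^sub>l)\<close> for \<open>h\<close> in \<open>X_ring l\<close>; the value at the \<open>Tv i\<close> is a dummy.\<close>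

definition eval_at :: "('k::comm_ring_1 \<Rightarrow> 'b \<Rightarrow> 'b) \<Rightarrow> 'b::comm_ring_1 list \<Rightarrow> 'k mpoly \<Rightarrow> 'b" where
  "eval_at scale fs h = subst_poly scale (\<lambda>x. case x of Xv j \<Rightarrow> fs ! j | Tv i \<Rightarrow> 0) h"

definition mon_deg :: "(mvar \<Rightarrow> 'g::comm_monoid_add) \<Rightarrow> (mvar \<Rightarrow>\<^sub>0 nat) \<Rightarrow> 'g" where
  "mon_deg w a = (\<Sum>x\<in>Poly_Mapping.keys a. \<Sum>n<Poly_Mapping.lookup a x. w x)"

definition homogeneous_poly :: "(mvar \<Rightarrow> 'g::comm_monoid_add) \<Rightarrow> 'k::zero mpoly \<Rightarrow> bool" where
  "homogeneous_poly w h \<longleftrightarrow> (\<exists>d. \<forall>a\<in>Poly_Mapping.keys h. mon_deg w a = d)"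

section \<open>MUVAK bases\<close>

definition faithfully_representable ::
  "('k::field \<Rightarrow> 'b::idom \<Rightarrow> 'b) \<Rightarrow> ('b \<Rightarrow> int) list \<Rightarrow> 'b \<Rightarrow> 'b list \<Rightarrow> bool" where
  "faithfully_representable scale vs f fs \<longleftrightarrow>
     (\<exists>h\<in>carrier (X_ring (length fs)).
        eval_at scale fs h = f \<and>
        (\<forall>t\<in>Supp h. \<forall>v\<in>set vs. ext_val v (eval_at scale fs t) \<ge> ext_val v f))"

definition muvak_basis ::
  "('k::field \<Rightarrow> 'b::idom \<Rightarrow> 'b) \<Rightarrow> 'b set \<Rightarrow> ('d \<Rightarrow> 'b set) \<Rightarrow> ('b \<Rightarrow> int) list \<Rightarrow> 'b set \<Rightarrow> bool" where
  "muvak_basis scale A Agr vs G \<longleftrightarrow>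
     G \<subseteq> A \<and> (\<forall>g\<in>G. homogeneous_elem Agr g) \<and> generated_alg scale G = A \<and>
     (\<forall>f\<in>A. homogeneous_elem Agr f \<longrightarrow>
        (\<exists>fs. set fs \<subseteq> G \<and> faithfully_representable scale vs f fs))"

section \<open>The ideals attached to a list of generators\<close>

definition Delta_weight :: "('d::zero \<Rightarrow> 'b set) \<Rightarrow> 'b list \<Rightarrow> mvar \<Rightarrow> 'd" where
  "Delta_weight Agr fs x = (case x of Xv j \<Rightarrow> degree_elem Agr (fs ! j) | Tv j \<Rightarrow> 0)"

definition val_weight :: "('b \<Rightarrow> int) list \<Rightarrow> 'b list \<Rightarrow> nat \<Rightarrow> mvar \<Rightarrow> int" where
  "val_weight vs fs i x =
     (case x of Xv j \<Rightarrow> (vs ! i) (fs ! j) | Tv j \<Rightarrow> if i = j then -1 else 0)"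

definition ideal_I :: "('k::field \<Rightarrow> 'b::idom \<Rightarrow> 'b) \<Rightarrow> 'b list \<Rightarrow> 'k mpoly set" where
  "ideal_I scale fs = {h \<in> carrier (X_ring (length fs)). eval_at scale fs h = 0}"

text \<open>
  The \<open>K\<close>-algebra homomorphism \<open>\<beta>\<close>; a scalar \<open>c\<close> is mapped to the class of \<open>c \<cdot> 1\<close> in degree \<open>(0, 0)\<close>.
  The kernel does not depend on whether the codomain is cut down to the subalgebra generated by
  the initial forms.
\<close>

definition beta ::
  "('k::field \<Rightarrow> 'b::idom \<Rightarrow> 'b) \<Rightarrow> ('d::ab_group_add \<Rightarrow> 'b set) \<Rightarrow> ('b \<Rightarrow> int) \<Rightarrow> 'b list \<Rightarrow>
   'k mpoly \<Rightarrow> 'd \<Rightarrow> int \<Rightarrow> 'b set" where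
  "beta scale Agr v fs h =
     (\<Oplus>\<^bsub>gr_group_ring v\<^esub>a\<in>Poly_Mapping.keys h.
        pure_tensor (gr_ring v) (gr_class v 0 (scale (Poly_Mapping.lookup h a) 1)) 0
        \<otimes>\<^bsub>gr_group_ring v\<^esub>
        (\<Otimes>\<^bsub>gr_group_ring v\<^esub>j\<in>{..<length fs}.
           initial_form_Delta Agr v (fs ! j) [^]\<^bsub>gr_group_ring v\<^esub> Poly_Mapping.lookup a (Xv j)))"

definition ideal_J ::
  "('k::field \<Rightarrow> 'b::idom \<Rightarrow> 'b) \<Rightarrow> ('d::ab_group_add \<Rightarrow> 'b set) \<Rightarrow> ('b \<Rightarrow> int) \<Rightarrow> 'b list \<Rightarrow>
   'k mpoly set" where
  "ideal_J scale Agr v fs =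
     {h \<in> carrier (X_ring (length fs)). beta scale Agr v fs h = \<zero>\<^bsub>gr_group_ring v\<^esub>}"

text \<open>The exponents are non-negative, so \<^const>\<open>nat\<close> does not truncate.\<close>

definition hom_poly :: "('b \<Rightarrow> int) list \<Rightarrow> 'b list \<Rightarrow> 'k::comm_ring_1 mpoly \<Rightarrow> 'k mpoly" where
  "hom_poly vs fs h =
     (let deg = (\<lambda>i. mon_deg (val_weight vs fs i));
          \<mu> = (\<lambda>i. Min (deg i ` Poly_Mapping.keys h))
      in \<Sum>a\<in>Poly_Mapping.keys h.
           Poly_Mapping.single a (Poly_Mapping.lookup h a) *
           (\<Prod>i<length vs. Var (Tv i) ^ nat (deg i a - \<mu> i)))"

definition hom_ideal ::
  "('b \<Rightarrow> int) list \<Rightarrow> 'b list \<Rightarrow> 'k::comm_ring_1 mpoly set \<Rightarrow> 'k mpoly set" where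
  "hom_ideal vs fs \<aa> = Idl\<^bsub>XT_ring (length fs) (length vs)\<^esub> (hom_poly vs fs ` \<aa>)"

definition deh :: "'k::comm_ring_1 mpoly \<Rightarrow> 'k mpoly" where
  "deh h = subst_poly (\<lambda>c p. Const c * p) (\<lambda>x. case x of Xv j \<Rightarrow> Var (Xv j) | Tv i \<Rightarrow> 1) h"

section \<open>The algorithm\<close>

text \<open>\<open>hom_J \<dots> i\<close> is the homogenization of \<open>J\<^sub>i\<close>, and \<open>test_ideal \<dots> i\<close> is that of \<open>I\<close> plus \<open>\<langle>t\<^sub>i\<rangle>\<close>.\<close>

definition hom_J ::
  "('k::field \<Rightarrow> 'b::idom \<Rightarrow> 'b) \<Rightarrow> ('d::ab_group_add \<Rightarrow> 'b set) \<Rightarrow> ('b \<Rightarrow> int) list \<Rightarrow> 'b list \<Rightarrow>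
   nat \<Rightarrow> 'k mpoly set" where
  "hom_J scale Agr vs fs i = hom_ideal vs fs (ideal_J scale Agr (vs ! i) fs)"

definition test_ideal ::
  "('k::field \<Rightarrow> 'b::idom \<Rightarrow> 'b) \<Rightarrow> ('b \<Rightarrow> int) list \<Rightarrow> 'b list \<Rightarrow> nat \<Rightarrow> 'k mpoly set" where
  "test_ideal scale vs fs i =
     hom_ideal vs fs (ideal_I scale fs)
       <+>\<^bsub>XT_ring (length fs) (length vs)\<^esub> PIdl\<^bsub>XT_ring (length fs) (length vs)\<^esub> (Var (Tv i))"

definition loop_condition ::
  "('k::field \<Rightarrow> 'b::idom \<Rightarrow> 'b) \<Rightarrow> ('d::ab_group_add \<Rightarrow> 'b set) \<Rightarrow> ('b \<Rightarrow> int) list \<Rightarrow> 'b list \<Rightarrow>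
   bool" where
  "loop_condition scale Agr vs fs \<longleftrightarrow>
     (\<exists>i<length vs. \<not> hom_J scale Agr vs fs i \<subseteq> test_ideal scale vs fs i)"

text \<open>
  A state of the algorithm is the set \<open>\<G>\<close>, given by an enumeration \<open>fs\<close> without repetitions.
  \<open>for_step \<dots> i fs fs'\<close> says that \<open>fs'\<close> enumerates a possible result of the \<open>i\<close>-th pass of the
  for-loop from state \<open>fs\<close>; the choice of the generators \<open>hs\<close> and of the enumeration is free.
\<close>

definition for_step ::
  "('k::field \<Rightarrow> 'b::idom \<Rightarrow> 'b) \<Rightarrow> ('d::ab_group_add \<Rightarrow> 'b set) \<Rightarrow> ('b \<Rightarrow> int) list \<Rightarrow> nat \<Rightarrow>
   'b list \<Rightarrow> 'b list \<Rightarrow> bool" where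
  "for_step scale Agr vs i fs fs' \<longleftrightarrow>
     (\<exists>hs. set hs \<subseteq> carrier (XT_ring (length fs) (length vs)) \<and>
           Idl\<^bsub>XT_ring (length fs) (length vs)\<^esub> (set hs) = hom_J scale Agr vs fs i \<and>
           (\<forall>h\<in>set hs. homogeneous_poly (Delta_weight Agr fs) h \<and>
              (\<forall>n<length vs. homogeneous_poly (val_weight vs fs n) h)) \<and>
           distinct fs' \<and>
           set fs' = set fs \<union>
             {eval_at scale fs (deh h) | h. h \<in> set hs \<and> h \<notin> test_ideal scale vs fs i})"

definition loop_body ::
  "('k::field \<Rightarrow> 'b::idom \<Rightarrow> 'b) \<Rightarrow> ('d::ab_group_add \<Rightarrow> 'b set) \<Rightarrow> ('b \<Rightarrow> int) list \<Rightarrow>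
   'b list \<Rightarrow> 'b list \<Rightarrow> bool" where
  "loop_body scale Agr vs fs fs' \<longleftrightarrow>
     (\<exists>gs. gs 0 = fs \<and> gs (length vs) = fs' \<and>
           (\<forall>i<length vs. for_step scale Agr vs i (gs i) (gs (Suc i))))"

text \<open>
  A run is recorded by the states \<open>s 0, s 1, \<dots>\<close> at the successive tests of the while-condition,
  the final state being repeated forever once the condition fails.
\<close>

definition muvak_run ::
  "('k::field \<Rightarrow> 'b::idom \<Rightarrow> 'b) \<Rightarrow> ('d::ab_group_add \<Rightarrow> 'b set) \<Rightarrow> ('b \<Rightarrow> int) list \<Rightarrow>
   'b list \<Rightarrow> (nat \<Rightarrow> 'b list) \<Rightarrow> bool" where
  "muvak_run scale Agr vs fs s \<longleftrightarrow>
     distinct (s 0) \<and> set (s 0) = set fs \<and>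
     (\<forall>n. if loop_condition scale Agr vs (s n) then loop_body scale Agr vs (s n) (s (Suc n))
          else s (Suc n) = s n)"

definition terminates ::
  "('k::field \<Rightarrow> 'b::idom \<Rightarrow> 'b) \<Rightarrow> ('d::ab_group_add \<Rightarrow> 'b set) \<Rightarrow> ('b \<Rightarrow> int) list \<Rightarrow>
   (nat \<Rightarrow> 'b list) \<Rightarrow> bool" where
  "terminates scale Agr vs s \<longleftrightarrow> (\<exists>n. \<not> loop_condition scale Agr vs (s n))"

definition run_output ::
  "('k::field \<Rightarrow> 'b::idom \<Rightarrow> 'b) \<Rightarrow> ('d::ab_group_add \<Rightarrow> 'b set) \<Rightarrow> ('b \<Rightarrow> int) list \<Rightarrow>
   (nat \<Rightarrow> 'b list) \<Rightarrow> 'b set" where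
  "run_output scale Agr vs s = set (s (LEAST n. \<not> loop_condition scale Agr vs (s n)))"

end

theory Submission
  imports Defs
begin

text \<open>
  Write a homogeneous \<open>f\<close> as a polynomial \<open>h\<close> in the current generators whose terms all have
  multidegree at least \<open>d\<close>. If \<open>d i < v i f\<close>, the terms of \<open>h\<close> of \<open>i\<close>-th degree \<open>d i\<close> cancel in the
  associated graded ring, so they form an element of \<open>J i\<close>. If the test for \<open>i\<close> succeeds, this element
  can be replaced modulo \<open>I\<close> by terms of \<open>i\<close>-th degree at least \<open>d i + 1\<close>, without lowering the other
  degrees; if it fails, the generators added in the \<open>i\<close>-th pass have values large enough to do the same.
  Hence once all tests succeed, every \<open>f\<close> is faithfully representable. Conversely, each execution of the
  loop body improves every \<open>d i < v i f\<close> by one, so after finitely many rounds all elements of a given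
  finite MUVAK basis are faithfully representable in the current generators. These then form a MUVAK
  basis themselves, and over a MUVAK basis all tests succeed.
\<close>

section \<open>The associated graded ring as a quotient of a group algebra\<close>

text \<open>The obstacle is that one value must be raised while all others are kept: cancelling the
  lowest \<open>i\<close>-th terms by an arbitrary relation could push another degree below its
  bound. Homogenizing for all gradings at once prevents this. For every integer vector
  \<open>d\<close>, the polynomials whose terms all have multidegree at least \<open>d\<close>
  correspond to the component of multidegree \<open>d\<close> in the ring with the additional
  variables \<open>Tv n\<close>. There, multiplication by \<open>Tv i\<close> is the inclusion of
  the step at \<open>d\<close> plus the \<open>i\<close>-th unit vector into the step at
  \<open>d\<close>. A component of multidegree \<open>d\<close> of an element of
  \<open>I^hom + <t_i>\<close> therefore evaluates into the smaller step, which is the gain of one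
  at \<open>i\<close> without loss elsewhere. If a Delta-homogeneous generator of
  \<open>J_i^hom\<close> of multidegree \<open>d\<close> fails the test, its value in the algebra is
  nonzero, has every \<open>n\<close>-th valuation at least \<open>d n\<close>, and at
  \<open>i\<close> even more than \<open>d i\<close>. As a new generator it provides the same
  gain.\<close>

lemma lookup_times_group:
  fixes x y :: "'d::ab_group_add \<Rightarrow>\<^sub>0 't::comm_ring_1"
  shows "Poly_Mapping.lookup (x * y) \<delta>
    = (\<Sum>\<epsilon>\<in>Poly_Mapping.keys x. Poly_Mapping.lookup x \<epsilon> * Poly_Mapping.lookup y (\<delta> - \<epsilon>))"
proof -
  have *: "(\<delta> = l + q) = (\<delta> - l = q)" for l q :: 'd
    by (auto simp: algebra_simps)
  have "Poly_Mapping.lookup (x * y) \<delta>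
    = Sum_any (\<lambda>l. Poly_Mapping.lookup x l * Poly_Mapping.lookup y (\<delta> - l))"
    by (simp add: lookup_mult prod_fun_def * )
  also have "\<dots> = (\<Sum>\<epsilon>\<in>Poly_Mapping.keys x. Poly_Mapping.lookup x \<epsilon> * Poly_Mapping.lookup y (\<delta> - \<epsilon>))"
    by (rule Sum_any.expand_superset) (auto simp: in_keys_iff)
  finally show ?thesis .
qed

text \<open>
  The ring axioms of \<^const>\<open>gr_ring\<close> and \<^const>\<open>group_ring\<close> are obtained by exhibiting these structures
  as images of subrings of group algebras realized as finitely supported functions.
\<close>

locale ring_surjection =
  fixes T :: "'t::comm_ring_1 set" and \<phi> :: "'t \<Rightarrow> 'a" and S :: "('a, 'm) ring_scheme"
  assumes T_0: "0 \<in> T" and T_1: "1 \<in> T"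
    and T_add: "x \<in> T \<Longrightarrow> y \<in> T \<Longrightarrow> x + y \<in> T"
    and T_mult: "x \<in> T \<Longrightarrow> y \<in> T \<Longrightarrow> x * y \<in> T"
    and T_uminus: "x \<in> T \<Longrightarrow> - x \<in> T"
    and surj: "\<phi> ` T = carrier S"
    and hom_0: "\<phi> 0 = \<zero>\<^bsub>S\<^esub>" and hom_1: "\<phi> 1 = \<one>\<^bsub>S\<^esub>"
    and hom_add: "x \<in> T \<Longrightarrow> y \<in> T \<Longrightarrow> \<phi> (x + y) = \<phi> x \<oplus>\<^bsub>S\<^esub> \<phi> y"
    and hom_mult: "x \<in> T \<Longrightarrow> y \<in> T \<Longrightarrow> \<phi> (x * y) = \<phi> x \<otimes>\<^bsub>S\<^esub> \<phi> y"
begin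

lemma hom_closed: "x \<in> T \<Longrightarrow> \<phi> x \<in> carrier S"
  using surj by blast

lemma carrier_cases:
  assumes "y \<in> carrier S" obtains x where "x \<in> T" "y = \<phi> x"
  using assms surj by blast

lemma cring: "cring S"
proof (intro cringI abelian_groupI comm_monoidI)
  fix x assume "x \<in> carrier S"
  then obtain a where a: "a \<in> T" "x = \<phi> a" by (rule carrier_cases)
  show "\<exists>y\<in>carrier S. y \<oplus>\<^bsub>S\<^esub> x = \<zero>\<^bsub>S\<^esub>"
    using a by (intro bexI[of _ "\<phi> (- a)"])
      (auto simp: hom_0 T_uminus hom_closed simp flip: hom_add)
  show "\<one>\<^bsub>S\<^esub> \<otimes>\<^bsub>S\<^esub> x = x" "\<zero>\<^bsub>S\<^esub> \<oplus>\<^bsub>S\<^esub> x = x"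
    using a by (simp_all add: T_0 T_1 flip: hom_0 hom_1 hom_add hom_mult)
  fix y assume "y \<in> carrier S"
  then obtain b where b: "b \<in> T" "y = \<phi> b" by (rule carrier_cases)
  show "x \<oplus>\<^bsub>S\<^esub> y \<in> carrier S" "x \<otimes>\<^bsub>S\<^esub> y \<in> carrier S"
    using a b by (auto simp: T_add T_mult intro: hom_closed simp flip: hom_add hom_mult)
  show "x \<oplus>\<^bsub>S\<^esub> y = y \<oplus>\<^bsub>S\<^esub> x" "x \<otimes>\<^bsub>S\<^esub> y = y \<otimes>\<^bsub>S\<^esub> x"
    using a b by (simp_all add: add.commute mult.commute flip: hom_add hom_mult)
  fix z assume "z \<in> carrier S"
  then obtain c where c: "c \<in> T" "z = \<phi> c" by (rule carrier_cases)
  show "x \<oplus>\<^bsub>S\<^esub> y \<oplus>\<^bsub>S\<^esub> z = x \<oplus>\<^bsub>S\<^esub> (y \<oplus>\<^bsub>S\<^esub> z)" "x \<otimes>\<^bsub>S\<^esub> y \<otimes>\<^bsub>S\<^esub> z = x \<otimes>\<^bsub>S\<^esub> (y \<otimes>\<^bsub>S\<^esub> z)"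
    using a b c by (simp_all add: T_add T_mult ac_simps flip: hom_add hom_mult)
  show "(x \<oplus>\<^bsub>S\<^esub> y) \<otimes>\<^bsub>S\<^esub> z = x \<otimes>\<^bsub>S\<^esub> z \<oplus>\<^bsub>S\<^esub> y \<otimes>\<^bsub>S\<^esub> z"
    using a b c by (simp add: T_add T_mult algebra_simps flip: hom_add hom_mult)
next
  show "\<zero>\<^bsub>S\<^esub> \<in> carrier S" "\<one>\<^bsub>S\<^esub> \<in> carrier S"
    using hom_closed[OF T_0] hom_closed[OF T_1] by (simp_all add: hom_0 hom_1)
qed

lemma T_sum: "(\<And>i. i \<in> I \<Longrightarrow> f i \<in> T) \<Longrightarrow> sum f I \<in> T"
  by (induction I rule: infinite_finite_induct) (auto simp: T_0 T_add)

lemma T_prod: "(\<And>i. i \<in> I \<Longrightarrow> f i \<in> T) \<Longrightarrow> prod f I \<in> T"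
  by (induction I rule: infinite_finite_induct) (auto simp: T_1 T_mult)

lemma T_power: "x \<in> T \<Longrightarrow> x ^ n \<in> T"
  by (induction n) (auto simp: T_1 T_mult)

lemma hom_sum:
  assumes "finite I" "\<And>i. i \<in> I \<Longrightarrow> f i \<in> T"
  shows "\<phi> (sum f I) = (\<Oplus>\<^bsub>S\<^esub>i\<in>I. \<phi> (f i))"
proof -
  interpret S: cring S by (rule cring)
  show ?thesis using assms
    by (induction I) (auto simp: hom_0 hom_add T_sum hom_closed)
qed

lemma hom_prod:
  assumes "finite I" "\<And>i. i \<in> I \<Longrightarrow> f i \<in> T"
  shows "\<phi> (prod f I) = (\<Otimes>\<^bsub>S\<^esub>i\<in>I. \<phi> (f i))"
proof -
  interpret S: cring S by (rule cring)
  show ?thesis using assms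
    by (induction I) (auto simp: hom_1 hom_mult T_prod hom_closed)
qed

lemma hom_power:
  assumes "x \<in> T" shows "\<phi> (x ^ n) = \<phi> x [^]\<^bsub>S\<^esub> n"
proof (induction n)
  case (Suc n)
  have "\<phi> (x ^ Suc n) = \<phi> (x ^ n * x)"
    by (simp add: mult.commute)
  with Suc assms show ?case
    by (simp add: hom_mult T_power)
qed (simp add: hom_1)

text \<open>The product of \<open>group_ring\<close> sums over the places where the image of
  \<open>x\<close> is nonzero, the convolution over all keys of \<open>x\<close>. The extra keys are
  mapped to zero and contribute nothing.\<close>

lemma group_ring_surjection:
  "ring_surjection {x. \<forall>\<delta>. Poly_Mapping.lookup x \<delta> \<in> T}
     (\<lambda>x (\<delta>::'d::ab_group_add). \<phi> (Poly_Mapping.lookup x \<delta>)) (group_ring S)"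
proof -
  interpret S: cring S by (rule cring)
  have mult: "\<phi> (Poly_Mapping.lookup (x * y) \<delta>)
    = (\<Oplus>\<^bsub>S\<^esub>\<epsilon>\<in>{\<epsilon>. \<phi> (Poly_Mapping.lookup x \<epsilon>) \<noteq> \<zero>\<^bsub>S\<^esub>}.
        \<phi> (Poly_Mapping.lookup x \<epsilon>) \<otimes>\<^bsub>S\<^esub> \<phi> (Poly_Mapping.lookup y (\<delta> - \<epsilon>)))"
    if "\<forall>\<delta>. Poly_Mapping.lookup x \<delta> \<in> T" "\<forall>\<delta>. Poly_Mapping.lookup y \<delta> \<in> T"
    for x y :: "'d \<Rightarrow>\<^sub>0 't" and \<delta>
  proof -
    have "\<phi> (Poly_Mapping.lookup (x * y) \<delta>) = (\<Oplus>\<^bsub>S\<^esub>\<epsilon>\<in>Poly_Mapping.keys x.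
        \<phi> (Poly_Mapping.lookup x \<epsilon>) \<otimes>\<^bsub>S\<^esub> \<phi> (Poly_Mapping.lookup y (\<delta> - \<epsilon>)))"
      using that by (simp add: lookup_times_group hom_sum T_mult hom_mult)
    also have "\<dots> = (\<Oplus>\<^bsub>S\<^esub>\<epsilon>\<in>{\<epsilon>. \<phi> (Poly_Mapping.lookup x \<epsilon>) \<noteq> \<zero>\<^bsub>S\<^esub>}.
        \<phi> (Poly_Mapping.lookup x \<epsilon>) \<otimes>\<^bsub>S\<^esub> \<phi> (Poly_Mapping.lookup y (\<delta> - \<epsilon>)))"
      using that by (intro S.add.finprod_mono_neutral_cong_right)
        (auto simp: in_keys_iff hom_0 hom_closed)
    finally show ?thesis .
  qed
  have T_m: "\<forall>\<delta>. Poly_Mapping.lookup (x * y) \<delta> \<in> T"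
    if "\<forall>\<delta>. Poly_Mapping.lookup x \<delta> \<in> T" "\<forall>\<delta>. Poly_Mapping.lookup y \<delta> \<in> T"
    for x y :: "'d \<Rightarrow>\<^sub>0 't"
    using that by (auto simp: lookup_times_group intro!: T_sum T_mult)
  have "y \<in> (\<lambda>x \<delta>. \<phi> (Poly_Mapping.lookup x \<delta>)) ` {x. \<forall>\<delta>. Poly_Mapping.lookup x \<delta> \<in> T}"
    if y: "y \<in> carrier (group_ring S)" for y :: "'d \<Rightarrow> 'a"
  proof -
    \<comment> \<open>Zero is always lifted to \<open>0\<close>, so the chosen lifts again have
      finite support.\<close>
    have "\<exists>t\<in>T. y \<delta> = \<phi> t \<and> (y \<delta> = \<zero>\<^bsub>S\<^esub> \<longrightarrow> t = 0)" for \<delta>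
    proof (cases "y \<delta> = \<zero>\<^bsub>S\<^esub>")
      case False
      have "y \<delta> \<in> carrier S" using y by (simp add: group_ring_def)
      then show ?thesis using False surj by blast
    qed (simp add: T_0 hom_0)
    then obtain g where g: "\<And>\<delta>. g \<delta> \<in> T" "\<And>\<delta>. y \<delta> = \<phi> (g \<delta>)" "\<And>\<delta>. y \<delta> = \<zero>\<^bsub>S\<^esub> \<longrightarrow> g \<delta> = 0"
      by metis
    have "finite {\<delta>. y \<delta> \<noteq> \<zero>\<^bsub>S\<^esub>}" using y by (simp add: group_ring_def)
    then have "finite {\<delta>. g \<delta> \<noteq> 0}"
      by (rule rev_finite_subset) (use g in auto)
    then have "Poly_Mapping.lookup (Abs_poly_mapping g) = g"
      by (rule lookup_Abs_poly_mapping)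
    with g show ?thesis
      by (intro image_eqI[of _ _ "Abs_poly_mapping g"]) auto
  qed
  moreover have "(\<lambda>\<delta>. \<phi> (Poly_Mapping.lookup x \<delta>)) \<in> carrier (group_ring S)"
    if "\<forall>\<delta>. Poly_Mapping.lookup x \<delta> \<in> T" for x :: "'d \<Rightarrow>\<^sub>0 't"
  proof -
    have "finite {\<delta>. \<phi> (Poly_Mapping.lookup x \<delta>) \<noteq> \<zero>\<^bsub>S\<^esub>}"
      by (rule finite_subset[of _ "Poly_Mapping.keys x"]) (auto simp: in_keys_iff hom_0)
    with that show ?thesis by (simp add: group_ring_def hom_closed)
  qed
  ultimately have surj: "(\<lambda>x \<delta>. \<phi> (Poly_Mapping.lookup x \<delta>)) ` {x. \<forall>\<delta>. Poly_Mapping.lookup x \<delta> \<in> T}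
      = carrier (group_ring S :: ('d \<Rightarrow> 'a) ring)"
    by blast
  show ?thesis
    by unfold_locales
      (use surj mult T_m in \<open>auto simp: T_0 T_1 T_add T_uminus lookup_add hom_0 hom_1 hom_add
        lookup_one when_def group_ring_def fun_eq_iff\<close>)
qed

end

section \<open>Sums of cosets of an additive subgroup\<close>

lemma coset_eq_self_iff:
  fixes H :: "'b::ab_group_add set"
  assumes "0 \<in> H" "\<And>x y. x \<in> H \<Longrightarrow> y \<in> H \<Longrightarrow> x + y \<in> H" "\<And>x. x \<in> H \<Longrightarrow> - x \<in> H"
  shows "f +o H = H \<longleftrightarrow> f \<in> H"
proof
  assume "f \<in> H"
  then have "x \<in> f +o H" if "x \<in> H" for x
    using that assms(2)[of x "- f"] assms(3)[of f] by (auto simp flip: set_minus_plus)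
  moreover have "f +o H \<subseteq> H"
    using \<open>f \<in> H\<close> assms(2) by (auto simp: elt_set_plus_def)
  ultimately show "f +o H = H" by blast
next
  assume "f +o H = H"
  then show "f \<in> H" using set_plus_intro2[OF assms(1), of f] by simp
qed

text \<open>\<open>P\<close> stands for an elementwise product of two cosets, which may miss
  elements of the coset that contains it. Adding \<open>H\<close> restores them.\<close>

lemma add_coset_absorb:
  fixes H :: "'b::ab_group_add set"
  assumes "\<And>x y. x \<in> H \<Longrightarrow> y \<in> H \<Longrightarrow> x + y \<in> H" "\<And>x. x \<in> H \<Longrightarrow> - x \<in> H"
    and "P \<subseteq> c +o H" "c \<in> P"
  shows "H + P = c +o H"
proof
  show "H + P \<subseteq> c +o H"
  proof
    fix z assume "z \<in> H + P"
    then obtain h p where hp: "z = h + p" "h \<in> H" "p \<in> P" by (rule set_plus_elim)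
    then have "p - c \<in> H" using assms(3) by (auto simp: set_minus_plus)
    then show "z \<in> c +o H"
      using assms(1)[of h "p - c"] hp by (simp add: algebra_simps flip: set_minus_plus)
  qed
  show "c +o H \<subseteq> H + P"
    by (rule set_plus_mono4[OF assms(4)])
qed

text \<open>A single summand \<open>H\<close> serves all the \<open>P e\<close>: once it has
  completed one of them to a coset, it is split off again and passed to the next. This is the form
  of the product in \<open>gr_ring\<close>.\<close>

lemma add_sum_coset_absorb:
  fixes H :: "'b::ab_group_add set"
  assumes H: "\<And>x y. x \<in> H \<Longrightarrow> y \<in> H \<Longrightarrow> x + y \<in> H" "\<And>x. x \<in> H \<Longrightarrow> - x \<in> H"
    and "finite E" and P: "\<And>e. e \<in> E \<Longrightarrow> P e \<subseteq> c e +o H \<and> c e \<in> P e"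
  shows "H + sum P E = sum c E +o H"
  using assms(3) P
proof (induction E)
  case empty
  then show ?case by simp
next
  case (insert e E)
  have "H + sum P (insert e E) = (H + sum P E) + P e"
    using insert(1,2) by (simp add: ac_simps)
  also have "H + sum P E = sum c E +o H"
    using insert by blast
  also have "sum c E +o H + P e = sum c E +o (H + P e)"
    by (rule set_plus_rearrange3)
  also have "H + P e = c e +o H"
    using insert.prems by (intro add_coset_absorb H) auto
  finally show ?case
    using insert by (simp add: set_plus_rearrange2 add.commute)
qed

context comm_algebra
begin

lemma scale_mult_right: "scale c (x * y) = x * scale c y"
  by (metis scale_mult_left mult.commute)

lemma scale_conv_mult: "scale c x = scale c 1 * x"
  by (metis scale_mult_left mult_1)

end

section \<open>The filtration of a single valuation and its graded ring\<close>

locale valued_algebra = comm_algebra +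
  fixes v
  assumes val: "valuation scale v"
begin

lemma val_add: "f \<noteq> 0 \<Longrightarrow> g \<noteq> 0 \<Longrightarrow> f + g \<noteq> 0 \<Longrightarrow> v (f + g) \<ge> min (v f) (v g)"
  and val_mult: "f \<noteq> 0 \<Longrightarrow> g \<noteq> 0 \<Longrightarrow> v (f * g) = v f + v g"
  and val_scale: "c \<noteq> 0 \<Longrightarrow> f \<noteq> 0 \<Longrightarrow> v (scale c f) = v f"
  using val by (auto simp: valuation_def)

lemma val_1: "v 1 = 0"
  using val_mult[of 1 1] by simp

lemma val_uminus: "v (- f) = v f"
  using val_scale[of "- 1" f] by (cases "f = 0") auto

lemma val_scalar: "c \<noteq> 0 \<Longrightarrow> v (scale c 1) = 0"
  by (simp add: val_scale val_1)

lemma F_ge_iff: "f \<in> F_ge v \<gamma> \<longleftrightarrow> (f \<noteq> 0 \<longrightarrow> v f \<ge> \<gamma>)"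
  by (auto simp: F_ge_def)

text \<open>Values are integers, so the strict step is just the next step, and closure properties
  have to be proved for \<open>F_ge\<close> only.\<close>

lemma F_gt_eq_F_ge: "F_gt v \<gamma> = F_ge v (\<gamma> + 1)"
  by (auto simp: F_ge_def F_gt_def)

lemma F_gt_iff: "f \<in> F_gt v \<gamma> \<longleftrightarrow> (f \<noteq> 0 \<longrightarrow> v f > \<gamma>)"
  by (auto simp: F_gt_def)

lemma F_ge_0 [simp]: "0 \<in> F_ge v \<gamma>"
  by (simp add: F_ge_iff)

lemma F_ge_add: "f \<in> F_ge v \<gamma> \<Longrightarrow> g \<in> F_ge v \<gamma> \<Longrightarrow> f + g \<in> F_ge v \<gamma>"
  using val_add[of f g] by (cases "f = 0 \<or> g = 0 \<or> f + g = 0") (auto simp: F_ge_iff)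

lemma F_ge_uminus: "f \<in> F_ge v \<gamma> \<Longrightarrow> - f \<in> F_ge v \<gamma>"
  by (simp add: F_ge_iff val_uminus)

lemma F_ge_mult: "f \<in> F_ge v \<gamma> \<Longrightarrow> g \<in> F_ge v \<epsilon> \<Longrightarrow> f * g \<in> F_ge v (\<gamma> + \<epsilon>)"
  by (auto simp: F_ge_iff val_mult)

lemma F_ge_mono: "f \<in> F_ge v \<gamma> \<Longrightarrow> \<epsilon> \<le> \<gamma> \<Longrightarrow> f \<in> F_ge v \<epsilon>"
  by (auto simp: F_ge_iff)

lemma F_ge_sum: "(\<And>i. i \<in> I \<Longrightarrow> f i \<in> F_ge v \<gamma>) \<Longrightarrow> sum f I \<in> F_ge v \<gamma>"
  by (induction I rule: infinite_finite_induct) (auto intro: F_ge_add)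

lemma coset_eq_F_gt_iff: "f +o F_gt v \<gamma> = F_gt v \<gamma> \<longleftrightarrow> f \<in> F_gt v \<gamma>"
  unfolding F_gt_eq_F_ge by (rule coset_eq_self_iff) (auto intro: F_ge_add F_ge_uminus)

lemma F_gt_add_self: "F_gt v \<gamma> + F_gt v \<gamma> = F_gt v \<gamma>"
  using add_coset_absorb[of "F_gt v \<gamma>" "F_gt v \<gamma>" 0]
  by (simp add: F_gt_eq_F_ge F_ge_add F_ge_uminus)

text \<open>For \<open>x\<close> and \<open>y\<close> in the two cosets,
  \<open>x * y - f * g = (x - f) * y + f * (y - g)\<close>, and in each summand one factor gains a
  degree.\<close>

lemma coset_mult_coset:
  assumes "f \<in> F_ge v \<gamma>" "g \<in> F_ge v \<epsilon>"
  shows "(f +o F_gt v \<gamma>) * (g +o F_gt v \<epsilon>) \<subseteq> f * g +o F_gt v (\<gamma> + \<epsilon>)"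
proof
  fix z assume "z \<in> (f +o F_gt v \<gamma>) * (g +o F_gt v \<epsilon>)"
  then obtain x y where xy: "z = x * y" "x - f \<in> F_gt v \<gamma>" "y - g \<in> F_gt v \<epsilon>"
    by (auto simp: set_minus_plus elim!: set_times_elim)
  have "y \<in> F_ge v \<epsilon>"
    using F_ge_add[of "y - g" \<epsilon> g] F_ge_mono[of "y - g" "\<epsilon> + 1" \<epsilon>] xy assms by (simp add: F_gt_eq_F_ge)
  then have "(x - f) * y \<in> F_ge v (\<gamma> + \<epsilon> + 1)"
    using F_ge_mult[of "x - f" "\<gamma> + 1" y \<epsilon>] xy by (simp add: F_gt_eq_F_ge ac_simps)
  moreover have "f * (y - g) \<in> F_ge v (\<gamma> + \<epsilon> + 1)"
    using F_ge_mult[of f \<gamma> "y - g" "\<epsilon> + 1"] xy assms by (simp add: F_gt_eq_F_ge ac_simps)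
  ultimately have "(x - f) * y + f * (y - g) \<in> F_ge v (\<gamma> + \<epsilon> + 1)"
    by (rule F_ge_add)
  then show "z \<in> f * g +o F_gt v (\<gamma> + \<epsilon>)"
    by (simp add: xy F_gt_eq_F_ge algebra_simps flip: set_minus_plus)
qed

text \<open>Finitely supported functions on the integers are Laurent polynomials over the domain.
  Those whose coefficient in every degree \<open>\<gamma>\<close> lies in
  \<open>F_ge v \<gamma>\<close> form the Rees ring of \<open>v\<close>, and this map is its
  reduction to the associated graded ring.\<close>

definition gr_proj :: "(int \<Rightarrow>\<^sub>0 'b) \<Rightarrow> int \<Rightarrow> 'b set" where
  "gr_proj x = (\<lambda>\<gamma>. Poly_Mapping.lookup x \<gamma> +o F_gt v \<gamma>)"

text \<open>The product in \<open>gr_ring\<close> runs only over degrees in which \<open>x\<close>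
  has a nonzero class. At the other keys the coefficient of \<open>x\<close> has a value above its
  degree, so the products there vanish modulo \<open>F_gt\<close>.\<close>

lemma gr_proj_mult:
  assumes "\<forall>\<gamma>. Poly_Mapping.lookup x \<gamma> \<in> F_ge v \<gamma>" "\<forall>\<gamma>. Poly_Mapping.lookup y \<gamma> \<in> F_ge v \<gamma>"
  shows "gr_proj (x * y) = gr_proj x \<otimes>\<^bsub>gr_ring v\<^esub> gr_proj y"
proof (rule ext)
  fix \<gamma>
  let ?E = "{\<epsilon>. gr_proj x \<epsilon> \<noteq> F_gt v \<epsilon>}"
  have E: "?E \<subseteq> Poly_Mapping.keys x"
    by (auto simp: gr_proj_def in_keys_iff)
  have "F_gt v \<gamma> + (\<Sum>\<epsilon>\<in>?E. gr_proj x \<epsilon> * gr_proj y (\<gamma> - \<epsilon>))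
    = (\<Sum>\<epsilon>\<in>?E. Poly_Mapping.lookup x \<epsilon> * Poly_Mapping.lookup y (\<gamma> - \<epsilon>)) +o F_gt v \<gamma>"
  proof (rule add_sum_coset_absorb)
    show "finite ?E" by (rule finite_subset[OF E]) simp
    fix \<epsilon>
    show "gr_proj x \<epsilon> * gr_proj y (\<gamma> - \<epsilon>)
          \<subseteq> Poly_Mapping.lookup x \<epsilon> * Poly_Mapping.lookup y (\<gamma> - \<epsilon>) +o F_gt v \<gamma> \<and>
        Poly_Mapping.lookup x \<epsilon> * Poly_Mapping.lookup y (\<gamma> - \<epsilon>) \<in> gr_proj x \<epsilon> * gr_proj y (\<gamma> - \<epsilon>)"
      using coset_mult_coset[of "Poly_Mapping.lookup x \<epsilon>" \<epsilon> "Poly_Mapping.lookup y (\<gamma> - \<epsilon>)" "\<gamma> - \<epsilon>"] assms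
        set_plus_intro2[of 0 "F_gt v \<epsilon>" "Poly_Mapping.lookup x \<epsilon>"]
        set_plus_intro2[of 0 "F_gt v (\<gamma> - \<epsilon>)" "Poly_Mapping.lookup y (\<gamma> - \<epsilon>)"]
      by (auto simp: gr_proj_def F_gt_iff)
  qed (auto simp: F_gt_eq_F_ge intro: F_ge_add F_ge_uminus)
  also have "\<dots> = gr_proj (x * y) \<gamma>"
  proof -
    have "(\<Sum>\<epsilon>\<in>Poly_Mapping.keys x - ?E. Poly_Mapping.lookup x \<epsilon> * Poly_Mapping.lookup y (\<gamma> - \<epsilon>)) \<in> F_ge v (\<gamma> + 1)"
    proof (rule F_ge_sum)
      fix \<epsilon> assume "\<epsilon> \<in> Poly_Mapping.keys x - ?E"
      then have "Poly_Mapping.lookup x \<epsilon> \<in> F_gt v \<epsilon>"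
        by (simp add: gr_proj_def coset_eq_F_gt_iff)
      then have "Poly_Mapping.lookup x \<epsilon> \<in> F_ge v (\<epsilon> + 1)"
        by (simp add: F_gt_eq_F_ge)
      from F_ge_mult[OF this, of "Poly_Mapping.lookup y (\<gamma> - \<epsilon>)" "\<gamma> - \<epsilon>"]
      show "Poly_Mapping.lookup x \<epsilon> * Poly_Mapping.lookup y (\<gamma> - \<epsilon>) \<in> F_ge v (\<gamma> + 1)"
        using assms by (simp add: add.commute)
    qed
    then have *: "(\<Sum>\<epsilon>\<in>Poly_Mapping.keys x - ?E.
        Poly_Mapping.lookup x \<epsilon> * Poly_Mapping.lookup y (\<gamma> - \<epsilon>)) +o F_gt v \<gamma> = F_gt v \<gamma>"
      unfolding coset_eq_F_gt_iff by (simp only: F_gt_eq_F_ge[of \<gamma>])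
    have "Poly_Mapping.lookup (x * y) \<gamma>
      = (\<Sum>\<epsilon>\<in>?E. Poly_Mapping.lookup x \<epsilon> * Poly_Mapping.lookup y (\<gamma> - \<epsilon>))
        + (\<Sum>\<epsilon>\<in>Poly_Mapping.keys x - ?E. Poly_Mapping.lookup x \<epsilon> * Poly_Mapping.lookup y (\<gamma> - \<epsilon>))"
      unfolding lookup_times_group by (subst sum.subset_diff[OF E]) (simp_all add: add.commute)
    then show ?thesis
      unfolding gr_proj_def using * by (simp add: gr_proj_def flip: set_plus_rearrange2)
  qed
  finally show "gr_proj (x * y) \<gamma> = (gr_proj x \<otimes>\<^bsub>gr_ring v\<^esub> gr_proj y) \<gamma>"
    by (simp add: gr_ring_def)
qed

lemma gr_ring_surjection:
  "ring_surjection {x. \<forall>\<gamma>. Poly_Mapping.lookup x \<gamma> \<in> F_ge v \<gamma>} gr_proj (gr_ring v)"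
proof -
  have T_m: "\<forall>\<gamma>. Poly_Mapping.lookup (x * y) \<gamma> \<in> F_ge v \<gamma>"
    if "\<forall>\<gamma>. Poly_Mapping.lookup x \<gamma> \<in> F_ge v \<gamma>" "\<forall>\<gamma>. Poly_Mapping.lookup y \<gamma> \<in> F_ge v \<gamma>" for x y
  proof
    fix \<gamma>
    have "Poly_Mapping.lookup x \<epsilon> * Poly_Mapping.lookup y (\<gamma> - \<epsilon>) \<in> F_ge v \<gamma>" for \<epsilon>
      using F_ge_mult[of "Poly_Mapping.lookup x \<epsilon>" \<epsilon> "Poly_Mapping.lookup y (\<gamma> - \<epsilon>)" "\<gamma> - \<epsilon>"] that
      by simp
    then show "Poly_Mapping.lookup (x * y) \<gamma> \<in> F_ge v \<gamma>"
      by (auto simp: lookup_times_group intro!: F_ge_sum)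
  qed
  have "y \<in> gr_proj ` {x. \<forall>\<gamma>. Poly_Mapping.lookup x \<gamma> \<in> F_ge v \<gamma>}"
    if y: "y \<in> carrier (gr_ring v)" for y
  proof -
    have "\<exists>f\<in>F_ge v \<gamma>. y \<gamma> = f +o F_gt v \<gamma> \<and> (y \<gamma> = F_gt v \<gamma> \<longrightarrow> f = 0)" for \<gamma>
    proof (cases "y \<gamma> = F_gt v \<gamma>")
      case False
      then show ?thesis using y by (auto simp: gr_ring_def)
    qed simp
    then obtain g where g: "\<And>\<gamma>. g \<gamma> \<in> F_ge v \<gamma>" "\<And>\<gamma>. y \<gamma> = g \<gamma> +o F_gt v \<gamma>"
        "\<And>\<gamma>. y \<gamma> = F_gt v \<gamma> \<longrightarrow> g \<gamma> = 0"
      by metis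
    have "finite {\<gamma>. y \<gamma> \<noteq> F_gt v \<gamma>}" using y by (simp add: gr_ring_def)
    then have "finite {\<gamma>. g \<gamma> \<noteq> 0}"
      by (rule rev_finite_subset) (use g in auto)
    then have "Poly_Mapping.lookup (Abs_poly_mapping g) = g"
      by (rule lookup_Abs_poly_mapping)
    with g show ?thesis
      by (intro image_eqI[of _ _ "Abs_poly_mapping g"]) (auto simp: gr_proj_def)
  qed
  moreover have "gr_proj x \<in> carrier (gr_ring v)"
    if "\<forall>\<gamma>. Poly_Mapping.lookup x \<gamma> \<in> F_ge v \<gamma>" for x
  proof -
    have "finite {\<gamma>. gr_proj x \<gamma> \<noteq> F_gt v \<gamma>}"
      by (rule finite_subset[of _ "Poly_Mapping.keys x"]) (auto simp: in_keys_iff gr_proj_def)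
    with that show ?thesis by (auto simp: gr_ring_def gr_proj_def)
  qed
  ultimately have surj: "gr_proj ` {x. \<forall>\<gamma>. Poly_Mapping.lookup x \<gamma> \<in> F_ge v \<gamma>} = carrier (gr_ring v)"
    by blast
  have add: "gr_proj (x + y) = gr_proj x \<oplus>\<^bsub>gr_ring v\<^esub> gr_proj y" for x y
    by (simp add: gr_proj_def gr_ring_def lookup_add set_plus_rearrange F_gt_add_self)
  have one: "gr_proj 1 = \<one>\<^bsub>gr_ring v\<^esub>" "gr_proj 0 = \<zero>\<^bsub>gr_ring v\<^esub>"
    by (auto simp: gr_proj_def gr_ring_def lookup_one when_def fun_eq_iff)
  have "\<forall>\<gamma>. Poly_Mapping.lookup (1 :: int \<Rightarrow>\<^sub>0 'b) \<gamma> \<in> F_ge v \<gamma>"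
    by (auto simp: lookup_one when_def F_ge_iff val_1)
  then show ?thesis
    by unfold_locales
      (use surj T_m in \<open>auto simp: add one gr_proj_mult lookup_add intro: F_ge_add F_ge_uminus\<close>)
qed

lemma gr_proj_single: "gr_proj (Poly_Mapping.single \<gamma> f) = gr_class v \<gamma> f"
  by (auto simp: gr_proj_def gr_class_def lookup_single when_def fun_eq_iff)

definition Gr_proj :: "('d::ab_group_add \<Rightarrow>\<^sub>0 int \<Rightarrow>\<^sub>0 'b) \<Rightarrow> 'd \<Rightarrow> int \<Rightarrow> 'b set" where
  "Gr_proj x = (\<lambda>\<delta>. gr_proj (Poly_Mapping.lookup x \<delta>))"

lemma gr_group_ring_surjection:
  "ring_surjection {x. \<forall>\<delta> \<gamma>. Poly_Mapping.lookup (Poly_Mapping.lookup x \<delta>) \<gamma> \<in> F_ge v \<gamma>}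
    (Gr_proj :: ('d::ab_group_add \<Rightarrow>\<^sub>0 int \<Rightarrow>\<^sub>0 'b) \<Rightarrow> _) (gr_group_ring v)"
  using ring_surjection.group_ring_surjection[OF gr_ring_surjection]
  by (simp add: gr_group_ring_def Gr_proj_def[abs_def])

lemma Gr_proj_single:
  "Gr_proj (Poly_Mapping.single \<delta> (Poly_Mapping.single \<gamma> f))
    = pure_tensor (gr_ring v) (gr_class v \<gamma> f) \<delta>"
  by (auto simp: Gr_proj_def pure_tensor_def gr_proj_single lookup_single when_def fun_eq_iff)
    (simp add: gr_proj_def gr_ring_def)+

text \<open>This removes the cosets: vanishing in the graded group ring becomes one condition on
  values for each pair of degrees.\<close>

lemma Gr_proj_eq_0_iff:
  "Gr_proj x = \<zero>\<^bsub>gr_group_ring v\<^esub>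
    \<longleftrightarrow> (\<forall>\<delta> \<gamma>. Poly_Mapping.lookup (Poly_Mapping.lookup x \<delta>) \<gamma> \<in> F_gt v \<gamma>)"
  by (simp add: Gr_proj_def gr_proj_def gr_group_ring_def group_ring_def gr_ring_def fun_eq_iff
    coset_eq_F_gt_iff)

end

section \<open>Polynomials\<close>

text \<open>For \<open>g\<close> additive in its second argument this is the additive extension of
  \<open>g\<close> from terms to polynomials. Evaluation, dehomogenization and lifting all have this
  form.\<close>

definition linear_sum :: "('x \<Rightarrow> 'k \<Rightarrow> 'c::comm_monoid_add) \<Rightarrow> ('x \<Rightarrow>\<^sub>0 'k::zero) \<Rightarrow> 'c" where
  "linear_sum g p = (\<Sum>a\<in>Poly_Mapping.keys p. g a (Poly_Mapping.lookup p a))"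

lemma linear_sum_add:
  assumes "\<And>a. g a 0 = 0" "\<And>a c d. g a (c + d) = g a c + g a d"
  shows "linear_sum g (p + q) = linear_sum g p + linear_sum g q"
  unfolding linear_sum_def by (rule setsum_keys_plus_distrib) (auto simp: assms)

lemma linear_sum_zero [simp]: "linear_sum g 0 = 0"
  by (simp add: linear_sum_def)

lemma linear_sum_single:
  assumes "g a 0 = 0"
  shows "linear_sum g (Poly_Mapping.single a c) = g a c"
  using assms by (simp add: linear_sum_def)

lemma poly_mapping_sum_singles:
  fixes p :: "'x \<Rightarrow>\<^sub>0 'c::comm_monoid_add"
  shows "p = (\<Sum>a\<in>Poly_Mapping.keys p. Poly_Mapping.single a (Poly_Mapping.lookup p a))"
  by (rule poly_mapping_eqI)
    (simp add: lookup_sum lookup_single when_def sum.If_cases in_keys_iff)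

text \<open>The \<open>single\<close> case may assume that the monomial occurs in \<open>p\<close>.
  Membership of \<open>p\<close> in a polynomial ring can thus be used there without becoming part
  of the induction predicate.\<close>

lemma poly_mapping_sum_induct [case_names zero single add]:
  fixes p :: "'x \<Rightarrow>\<^sub>0 'c::comm_monoid_add"
  assumes "P 0" "\<And>a c. a \<in> Poly_Mapping.keys p \<Longrightarrow> P (Poly_Mapping.single a c)"
    and "\<And>p q. P p \<Longrightarrow> P q \<Longrightarrow> P (p + q)"
  shows "P p"
proof -
  have "P (\<Sum>a\<in>K. Poly_Mapping.single a (Poly_Mapping.lookup p a))"
    if "finite K" "K \<subseteq> Poly_Mapping.keys p" for K
    using that by (induction K) (auto simp: assms)
  from this[of "Poly_Mapping.keys p"] show ?thesis
    by (simp flip: poly_mapping_sum_singles)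
qed

lemma monomial_induct [case_names zero var add]:
  fixes a :: "'x \<Rightarrow>\<^sub>0 nat"
  assumes "P 0" "\<And>x. x \<in> Poly_Mapping.keys a \<Longrightarrow> P (Poly_Mapping.single x 1)"
    and add: "\<And>a b. P a \<Longrightarrow> P b \<Longrightarrow> P (a + b)"
  shows "P a"
proof (rule poly_mapping_sum_induct[of P a])
  fix x n assume x: "x \<in> Poly_Mapping.keys a"
  show "P (Poly_Mapping.single x n)"
  proof (induction n)
    case (Suc n)
    have "Poly_Mapping.single x (Suc n) = Poly_Mapping.single x n + Poly_Mapping.single x 1"
      by (simp flip: single_add)
    with Suc assms(2)[OF x] add show ?case by metis
  qed (simp add: assms)
qed (use assms in auto)

definition mon_eval :: "(mvar \<Rightarrow> 'c::comm_monoid_mult) \<Rightarrow> (mvar \<Rightarrow>\<^sub>0 nat) \<Rightarrow> 'c" where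
  "mon_eval \<sigma> a = (\<Prod>x\<in>Poly_Mapping.keys a. \<sigma> x ^ Poly_Mapping.lookup a x)"

lemma mon_eval_zero [simp]: "mon_eval \<sigma> 0 = 1"
  by (simp add: mon_eval_def)

lemma mon_eval_superset:
  assumes "finite S" "Poly_Mapping.keys a \<subseteq> S"
  shows "mon_eval \<sigma> a = (\<Prod>x\<in>S. \<sigma> x ^ Poly_Mapping.lookup a x)"
  unfolding mon_eval_def
  by (rule prod.mono_neutral_left) (use assms in \<open>auto simp: in_keys_iff\<close>)

lemma keys_plus_nat: "Poly_Mapping.keys (a + b) = Poly_Mapping.keys a \<union> Poly_Mapping.keys b"
  for a b :: "'x \<Rightarrow>\<^sub>0 nat"
  by (auto simp: in_keys_iff lookup_add)

lemma mon_eval_plus: "mon_eval \<sigma> (a + b) = mon_eval \<sigma> a * mon_eval \<sigma> b"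
  by (simp add: mon_eval_superset[of "Poly_Mapping.keys a \<union> Poly_Mapping.keys b"] keys_plus_nat
    lookup_add power_add prod.distrib)

lemma mon_eval_single [simp]: "mon_eval \<sigma> (Poly_Mapping.single x n) = \<sigma> x ^ n"
  by (cases "n = 0") (simp_all add: mon_eval_def)

lemma mon_deg_superset:
  assumes "finite S" "Poly_Mapping.keys a \<subseteq> S"
  shows "mon_deg w a = (\<Sum>x\<in>S. \<Sum>n<Poly_Mapping.lookup a x. w x)"
  unfolding mon_deg_def
  by (rule sum.mono_neutral_left) (use assms in \<open>auto simp: in_keys_iff\<close>)

lemma sum_const_add_nat:
  fixes c :: "'c::comm_monoid_add" and m n :: nat
  shows "(\<Sum>k<m + n. c) = (\<Sum>k<m. c) + (\<Sum>k<n. c)"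
  by (induction n) (simp_all add: ac_simps)

lemma mon_deg_zero [simp]: "mon_deg w 0 = 0"
  by (simp add: mon_deg_def)

lemma mon_deg_plus: "mon_deg w (a + b) = mon_deg w a + mon_deg w b"
  by (simp add: mon_deg_superset[of "Poly_Mapping.keys a \<union> Poly_Mapping.keys b"] keys_plus_nat
    lookup_add sum_const_add_nat sum.distrib)

lemma mon_deg_single: "mon_deg w (Poly_Mapping.single x n) = (\<Sum>k<n. w x)"
  by (cases "n = 0") (simp_all add: mon_deg_def)

lemma mon_deg_sum: "mon_deg w (\<Sum>i\<in>I. f i) = (\<Sum>i\<in>I. mon_deg w (f i))"
  by (induction I rule: infinite_finite_induct) (simp_all add: mon_deg_plus)

lemma subst_poly_eq: "subst_poly scale \<sigma> h = linear_sum (\<lambda>a c. scale c (mon_eval \<sigma> a)) h"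
  by (simp add: subst_poly_def linear_sum_def mon_eval_def)

definition x_part :: "(mvar \<Rightarrow>\<^sub>0 nat) \<Rightarrow> mvar \<Rightarrow>\<^sub>0 nat" where
  "x_part a = Poly_Mapping.mapp (\<lambda>x n. case x of Xv j \<Rightarrow> n | Tv i \<Rightarrow> 0) a"

lemma lookup_x_part:
  "Poly_Mapping.lookup (x_part a) (Xv j) = Poly_Mapping.lookup a (Xv j)"
  "Poly_Mapping.lookup (x_part a) (Tv i) = 0"
  by (simp_all add: x_part_def lookup_mapp when_def in_keys_iff)

lemma poly_mapping_mvar_eqI:
  assumes "\<And>j. Poly_Mapping.lookup a (Xv j) = Poly_Mapping.lookup b (Xv j)"
    and "\<And>i. Poly_Mapping.lookup a (Tv i) = Poly_Mapping.lookup b (Tv i)"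
  shows "a = b"
proof (rule poly_mapping_eqI)
  show "Poly_Mapping.lookup a x = Poly_Mapping.lookup b x" for x
    by (cases x) (use assms in auto)
qed

lemma x_part_zero [simp]: "x_part 0 = 0"
  and x_part_plus: "x_part (a + b) = x_part a + x_part b"
  by (rule poly_mapping_mvar_eqI; simp add: lookup_x_part lookup_add)+

lemma x_part_single: "x_part (Poly_Mapping.single x n)
    = (case x of Xv j \<Rightarrow> Poly_Mapping.single x n | Tv i \<Rightarrow> 0)"
  by (rule poly_mapping_mvar_eqI)
    (auto simp: lookup_x_part lookup_single when_def split: mvar.split)

lemma x_part_sum: "x_part (\<Sum>i\<in>I. f i) = (\<Sum>i\<in>I. x_part (f i))"
  by (induction I rule: infinite_finite_induct) (simp_all add: x_part_plus)

lemma x_part_id: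
  assumes "Poly_Mapping.keys a \<subseteq> range Xv"
  shows "x_part a = a"
proof (rule poly_mapping_mvar_eqI)
  fix i
  have "Tv i \<notin> Poly_Mapping.keys a" using assms by auto
  then show "Poly_Mapping.lookup (x_part a) (Tv i) = Poly_Mapping.lookup a (Tv i)"
    by (simp add: lookup_x_part in_keys_iff)
qed (simp add: lookup_x_part)

lemma keys_x_part: "Poly_Mapping.keys (x_part a) = Poly_Mapping.keys a \<inter> range Xv"
proof (rule Set.set_eqI)
  show "x \<in> Poly_Mapping.keys (x_part a) \<longleftrightarrow> x \<in> Poly_Mapping.keys a \<inter> range Xv" for x
    by (cases x) (auto simp: in_keys_iff lookup_x_part)
qed

lemma deh_eq: "deh h = linear_sum (\<lambda>a c. Poly_Mapping.single (x_part a) c) h"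
proof -
  have "mon_eval (\<lambda>x. case x of Xv j \<Rightarrow> Var (Xv j) | Tv i \<Rightarrow> (1 :: 'a mpoly)) a
      = Poly_Mapping.single (x_part a) 1" for a
  proof (induction a rule: monomial_induct)
    case (var x)
    then show ?case by (cases x) (simp_all add: x_part_single Var_def)
  qed (simp_all add: mon_eval_plus x_part_plus mult_single)
  then show ?thesis
    by (simp add: deh_def subst_poly_eq Const_def mult_single)
qed

text \<open>The identity is taken as the surjection, so the ring axioms of \<open>poly_ring\<close>
  come from the same locale as those of the graded rings.\<close>

lemma poly_ring_surjection:
  "ring_surjection {h. \<forall>a\<in>Poly_Mapping.keys h. Poly_Mapping.keys a \<subseteq> V} (\<lambda>h. h)
    (poly_ring V :: 'k::comm_ring_1 mpoly ring)"
proof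
  fix x y :: "'k mpoly"
  assume x: "x \<in> {h. \<forall>a\<in>Poly_Mapping.keys h. Poly_Mapping.keys a \<subseteq> V}"
    and y: "y \<in> {h. \<forall>a\<in>Poly_Mapping.keys h. Poly_Mapping.keys a \<subseteq> V}"
  show "x + y \<in> {h. \<forall>a\<in>Poly_Mapping.keys h. Poly_Mapping.keys a \<subseteq> V}"
    using x y keys_add[of x y] by blast
  show "x * y \<in> {h. \<forall>a\<in>Poly_Mapping.keys h. Poly_Mapping.keys a \<subseteq> V}"
    using x y keys_mult[of x y] by (fastforce simp: keys_plus_nat)
qed (auto simp: poly_ring_def)

lemma cring_poly_ring: "cring (poly_ring V)"
  by (rule ring_surjection.cring[OF poly_ring_surjection])

lemma poly_ring_carrier_iff:
  "h \<in> carrier (poly_ring V) \<longleftrightarrow> (\<forall>a\<in>Poly_Mapping.keys h. Poly_Mapping.keys a \<subseteq> V)"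
  by (simp add: poly_ring_def)

lemma poly_ring_simps [simp]:
  "x \<otimes>\<^bsub>poly_ring V\<^esub> y = x * y" "x \<oplus>\<^bsub>poly_ring V\<^esub> y = x + y"
  "\<zero>\<^bsub>poly_ring V\<^esub> = 0" "\<one>\<^bsub>poly_ring V\<^esub> = 1"
  by (simp_all add: poly_ring_def)

lemma poly_ring_closed:
  "0 \<in> carrier (poly_ring V)"
  "x \<in> carrier (poly_ring V) \<Longrightarrow> y \<in> carrier (poly_ring V) \<Longrightarrow> x + y \<in> carrier (poly_ring V)"
  "x \<in> carrier (poly_ring V) \<Longrightarrow> y \<in> carrier (poly_ring V) \<Longrightarrow> x * y \<in> carrier (poly_ring V)"
  "x \<in> carrier (poly_ring V) \<Longrightarrow> - x \<in> carrier (poly_ring V)"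
  "x \<in> carrier (poly_ring V) \<Longrightarrow> y \<in> carrier (poly_ring V) \<Longrightarrow> x - y \<in> carrier (poly_ring V)"
proof -
  interpret cring "poly_ring V" by (rule cring_poly_ring)
  show "0 \<in> carrier (poly_ring V)" by (simp add: poly_ring_carrier_iff)
  show "x \<in> carrier (poly_ring V) \<Longrightarrow> y \<in> carrier (poly_ring V) \<Longrightarrow> x + y \<in> carrier (poly_ring V)"
    for x y using a_closed[of x y] by simp
  show "x \<in> carrier (poly_ring V) \<Longrightarrow> y \<in> carrier (poly_ring V) \<Longrightarrow> x * y \<in> carrier (poly_ring V)"
    for x y using m_closed[of x y] by simp
  show *: "x \<in> carrier (poly_ring V) \<Longrightarrow> - x \<in> carrier (poly_ring V)" for x
    by (simp add: poly_ring_carrier_iff)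
  show "x \<in> carrier (poly_ring V) \<Longrightarrow> y \<in> carrier (poly_ring V) \<Longrightarrow> x - y \<in> carrier (poly_ring V)"
    for x y using a_closed[of x "- y"] *[of y] by simp
qed

text \<open>Closure under negatives is implied by multiplication with \<open>- 1\<close>, which
  leaves only sums and multiples to be checked.\<close>

lemma poly_ring_ideal_iff:
  "ideal S (poly_ring V) \<longleftrightarrow> S \<subseteq> carrier (poly_ring V) \<and> 0 \<in> S \<and> (\<forall>x\<in>S. \<forall>y\<in>S. x + y \<in> S) \<and>
    (\<forall>q\<in>carrier (poly_ring V). \<forall>p\<in>S. q * p \<in> S)" (is "_ \<longleftrightarrow> ?R")
proof
  interpret cring "poly_ring V" by (rule cring_poly_ring)
  assume "ideal S (poly_ring V)"
  then interpret ideal S "poly_ring V" .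
  show ?R
    using a_subset zero_closed a_closed I_l_closed by auto
next
  interpret cring "poly_ring V" by (rule cring_poly_ring)
  assume R: ?R
  then have R': "p * q \<in> S" if "p \<in> S" "q \<in> carrier (poly_ring V)" for p q
    using that by (subst mult.commute) blast
  show "ideal S (poly_ring V)"
  proof (rule idealI)
    show "subgroup S (add_monoid (poly_ring V))"
    proof (rule add.subgroupI)
      fix x assume "x \<in> S"
      then have x: "x \<in> carrier (poly_ring V)" using R by blast
      have "(- 1) * x \<in> S"
        using R \<open>x \<in> S\<close> poly_ring_closed(4)[of 1 V] one_closed by (metis poly_ring_simps(4))
      moreover have "\<ominus>\<^bsub>poly_ring V\<^esub> x = - x"
        using x by (intro minus_equality) (auto simp: poly_ring_closed)
      ultimately show "\<ominus>\<^bsub>poly_ring V\<^esub> x \<in> S" by simp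
    qed (use R in auto)
  qed (use R R' ring_axioms in auto)
qed

section \<open>The kernels of initial form maps\<close>

definition restrict_mons :: "('x \<Rightarrow> bool) \<Rightarrow> ('x \<Rightarrow>\<^sub>0 'k::comm_ring_1) \<Rightarrow> 'x \<Rightarrow>\<^sub>0 'k" where
  "restrict_mons P h = Poly_Mapping.mapp (\<lambda>a c. if P a then c else 0) h"

lemma lookup_restrict_mons:
  "Poly_Mapping.lookup (restrict_mons P h) a = (if P a then Poly_Mapping.lookup h a else 0)"
  by (simp add: restrict_mons_def lookup_mapp when_def in_keys_iff)

lemma keys_restrict_mons: "Poly_Mapping.keys (restrict_mons P h) = {a \<in> Poly_Mapping.keys h. P a}"
  by (auto simp: in_keys_iff lookup_restrict_mons split: if_splits)

lemma restrict_mons_zero [simp]: "restrict_mons P 0 = 0"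
  by (rule poly_mapping_eqI) (simp add: lookup_restrict_mons)

lemma restrict_mons_add: "restrict_mons P (g + h) = restrict_mons P g + restrict_mons P h"
  by (rule poly_mapping_eqI) (simp add: lookup_restrict_mons lookup_add)

lemma restrict_mons_single:
  "restrict_mons P (Poly_Mapping.single a c) = (if P a then Poly_Mapping.single a c else 0)"
  by (rule poly_mapping_eqI) (simp add: lookup_restrict_mons lookup_single when_def)

lemma restrict_mons_split: "restrict_mons P h + restrict_mons (\<lambda>a. \<not> P a) h = h"
  by (rule poly_mapping_eqI) (simp add: lookup_restrict_mons lookup_add)

lemma restrict_mons_id: "(\<And>a. a \<in> Poly_Mapping.keys h \<Longrightarrow> P a) \<Longrightarrow> restrict_mons P h = h"
  by (rule poly_mapping_eqI) (auto simp: lookup_restrict_mons in_keys_iff)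

lemma restrict_mons_empty: "(\<And>a. a \<in> Poly_Mapping.keys h \<Longrightarrow> \<not> P a) \<Longrightarrow> restrict_mons P h = 0"
  by (rule poly_mapping_eqI) (auto simp: lookup_restrict_mons in_keys_iff)

lemma restrict_mons_cong:
  "(\<And>a. a \<in> Poly_Mapping.keys h \<Longrightarrow> P a = Q a) \<Longrightarrow> restrict_mons P h = restrict_mons Q h"
  by (rule poly_mapping_eqI) (auto simp: lookup_restrict_mons in_keys_iff)

lemma restrict_mons_restrict: "restrict_mons P (restrict_mons Q h) = restrict_mons (\<lambda>a. P a \<and> Q a) h"
  by (rule poly_mapping_eqI) (simp add: lookup_restrict_mons)

lemma restrict_mons_single_times:
  "restrict_mons P (Poly_Mapping.single b c * h)
    = Poly_Mapping.single b c * restrict_mons (\<lambda>a. P (b + a)) h"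
  by (induction h rule: poly_mapping_sum_induct)
    (simp_all add: restrict_mons_add restrict_mons_single mult_single distrib_left)

lemma sum_restrict_mons_fibers:
  "(\<Sum>\<delta>\<in>f ` Poly_Mapping.keys h. restrict_mons (\<lambda>a. f a = \<delta>) h) = h"
  by (rule poly_mapping_eqI) (auto simp: lookup_sum lookup_restrict_mons sum.If_cases in_keys_iff)

lemma restrict_mons_carrier:
  "h \<in> carrier (poly_ring V) \<Longrightarrow> restrict_mons P h \<in> carrier (poly_ring V)"
  by (simp add: poly_ring_carrier_iff keys_restrict_mons)

lemma deh_single: "deh (Poly_Mapping.single a c) = Poly_Mapping.single (x_part a) c"
  by (simp add: deh_eq linear_sum_single)

lemma deh_zero [simp]: "deh 0 = 0"
  by (simp add: deh_eq)

lemma deh_add: "deh (p + q) = deh p + deh q"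
  unfolding deh_eq by (rule linear_sum_add) (simp_all add: single_add)

lemma deh_single_times:
  "deh (Poly_Mapping.single b c * p) = Poly_Mapping.single (x_part b) c * deh p"
  by (induction p rule: poly_mapping_sum_induct)
    (simp_all add: deh_add deh_single mult_single distrib_left x_part_plus)

section \<open>Evaluation of polynomials\<close>

context comm_algebra
begin

abbreviation "assign fs \<equiv> (\<lambda>x. case x of Xv j \<Rightarrow> fs ! j | Tv i \<Rightarrow> (0 :: 'b))"

lemma eval_at_eq: "eval_at scale fs h = linear_sum (\<lambda>a c. scale c (mon_eval (assign fs) a)) h"
  by (simp add: eval_at_def subst_poly_eq)

lemma eval_at_zero [simp]: "eval_at scale fs 0 = 0"
  by (simp add: eval_at_eq)

lemma eval_at_single:
  "eval_at scale fs (Poly_Mapping.single a c) = scale c (mon_eval (assign fs) a)"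
  by (simp add: eval_at_eq linear_sum_single)

lemma eval_at_add: "eval_at scale fs (p + q) = eval_at scale fs p + eval_at scale fs q"
  unfolding eval_at_eq by (rule linear_sum_add) (simp_all add: scale_left_distrib)

lemma eval_at_diff: "eval_at scale fs (p - q) = eval_at scale fs p - eval_at scale fs q"
  using eval_at_add[of fs "p - q" q] by simp

lemma eval_at_sum: "eval_at scale fs (\<Sum>i\<in>I. p i) = (\<Sum>i\<in>I. eval_at scale fs (p i))"
  by (induction I rule: infinite_finite_induct) (simp_all add: eval_at_add)

lemma eval_at_single_times:
  "eval_at scale fs (Poly_Mapping.single b c * p)
    = scale c (mon_eval (assign fs) b) * eval_at scale fs p"
proof (induction p rule: poly_mapping_sum_induct)
  case (single a e)
  have "scale (c * e) (x * y) = scale c x * scale e y" for x y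
    by (metis scale_mult_left scale_mult_right scale_scale)
  then show ?case
    by (simp add: eval_at_single mult_single mon_eval_plus)
qed (simp_all add: eval_at_add distrib_left)

lemma eval_at_times: "eval_at scale fs (p * q) = eval_at scale fs p * eval_at scale fs q"
  by (induction p rule: poly_mapping_sum_induct)
    (simp_all add: eval_at_add eval_at_single_times eval_at_single distrib_right)

lemma eval_at_const: "eval_at scale fs (Poly_Mapping.single 0 c) = scale c 1"
  by (simp add: eval_at_single)

end

section \<open>Homogeneous elements and the degrees of monomials in the generators\<close>

locale muvak_setting = comm_algebra scale
  for scale :: "'k::field \<Rightarrow> 'b::idom \<Rightarrow> 'b" +
  fixes A :: "'b set" and Agr :: "'d::ab_group_add \<Rightarrow> 'b set" and vs :: "('b \<Rightarrow> int) list"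
  assumes graded: "graded_alg scale A Agr"
    and valuations: "v \<in> set vs \<Longrightarrow> valuation scale v"
begin

lemma val_nth: "n < length vs \<Longrightarrow> valued_algebra scale (vs ! n)"
  by unfold_locales (simp add: valuations)

lemma Agr_subspace: "subspace (Agr \<delta>)" and Agr_subset: "Agr \<delta> \<subseteq> A" and Agr_one: "1 \<in> Agr 0"
  and Agr_mult: "x \<in> Agr \<delta> \<Longrightarrow> y \<in> Agr \<epsilon> \<Longrightarrow> x * y \<in> Agr (\<delta> + \<epsilon>)"
  using graded by (auto simp: graded_alg_def)

text \<open>The given summands and the family concentrated in degree \<open>\<epsilon>\<close>
  decompose the same element, so uniqueness of the homogeneous decomposition identifies
  them.\<close>

lemma Agr_sum_unique:
  assumes "finite D" "\<And>\<delta>. \<delta> \<in> D \<Longrightarrow> x \<delta> \<in> Agr \<delta>" "(\<Sum>\<delta>\<in>D. x \<delta>) \<in> Agr \<epsilon>"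
  shows "(\<Sum>\<delta>\<in>D. x \<delta>) = (if \<epsilon> \<in> D then x \<epsilon> else 0)"
proof -
  let ?f = "\<Sum>\<delta>\<in>D. x \<delta>"
  define c where "c = (\<Sum>\<delta>\<in>D. Poly_Mapping.single \<delta> (x \<delta>))"
  have c: "Poly_Mapping.lookup c \<delta> = (if \<delta> \<in> D then x \<delta> else 0)" for \<delta>
    using assms(1) by (simp add: c_def lookup_sum lookup_single when_def)
  have "?f \<in> A" using assms(3) Agr_subset by blast
  then have "\<exists>!c :: 'd \<Rightarrow>\<^sub>0 'b. (\<forall>\<delta>. Poly_Mapping.lookup c \<delta> \<in> Agr \<delta>) \<and>
      ?f = (\<Sum>\<delta>\<in>Poly_Mapping.keys c. Poly_Mapping.lookup c \<delta>)"
    using graded unfolding graded_alg_def by blast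
  moreover have "\<forall>\<delta>. Poly_Mapping.lookup c \<delta> \<in> Agr \<delta>"
    using assms(2) subspace_0[OF Agr_subspace] by (simp add: c)
  moreover have "?f = (\<Sum>\<delta>\<in>Poly_Mapping.keys c. Poly_Mapping.lookup c \<delta>)"
    by (rule sum.mono_neutral_cong_right) (use assms(1) in \<open>auto simp: c in_keys_iff split: if_splits\<close>)
  moreover have "\<forall>\<delta>. Poly_Mapping.lookup (Poly_Mapping.single \<epsilon> ?f) \<delta> \<in> Agr \<delta>"
    using assms(3) subspace_0[OF Agr_subspace] by (simp add: lookup_single when_def)
  moreover have "?f = (\<Sum>\<delta>\<in>Poly_Mapping.keys (Poly_Mapping.single \<epsilon> ?f).
      Poly_Mapping.lookup (Poly_Mapping.single \<epsilon> ?f) \<delta>)"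
    by simp
  ultimately have "c = Poly_Mapping.single \<epsilon> ?f" by blast
  then show ?thesis using c[of \<epsilon>] by simp
qed

lemma degree_elem_eq:
  assumes "f \<noteq> 0" "f \<in> Agr \<delta>"
  shows "degree_elem Agr f = \<delta>"
  unfolding degree_elem_def
proof (rule the_equality)
  fix \<epsilon> assume "f \<in> Agr \<epsilon>"
  then show "\<epsilon> = \<delta>"
    using Agr_sum_unique[of "{\<delta>}" "\<lambda>_. f" \<epsilon>] assms by (auto split: if_splits)
qed (rule assms)

end

locale generators = muvak_setting scale A Agr vs
  for scale :: "'k::field \<Rightarrow> 'b::idom \<Rightarrow> 'b"
    and A :: "'b set" and Agr :: "'d::ab_group_add \<Rightarrow> 'b set" and vs :: "('b \<Rightarrow> int) list" +
  fixes fs :: "'b list"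
  assumes fs: "f \<in> set fs \<Longrightarrow> f \<noteq> 0 \<and> f \<in> A \<and> homogeneous_elem Agr f"
begin

abbreviation "is_xmon a \<equiv> Poly_Mapping.keys a \<subseteq> Xv ` {..<length fs}"
abbreviation "mval a \<equiv> mon_eval (assign fs) a"
abbreviation "ddeg a \<equiv> mon_deg (Delta_weight Agr fs) a"
abbreviation "vdeg n a \<equiv> mon_deg (val_weight vs fs n) a"
abbreviation "ev h \<equiv> eval_at scale fs h"
abbreviation "XR \<equiv> X_ring (length fs) :: 'k mpoly ring"
abbreviation "XTR \<equiv> XT_ring (length fs) (length vs) :: 'k mpoly ring"

lemma mval_ddeg: "is_xmon a \<Longrightarrow> mval a \<in> Agr (ddeg a)"
proof (induction a rule: monomial_induct)
  case zero
  then show ?case by (simp add: Agr_one)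
next
  case (var x)
  then obtain j where j: "x = Xv j" "j < length fs" by auto
  then have "fs ! j \<in> Agr (degree_elem Agr (fs ! j))"
    using fs[of "fs ! j"] degree_elem_eq by (auto simp: homogeneous_elem_def)
  then show ?case using j by (simp add: mon_deg_single Delta_weight_def)
next
  case (add a b)
  then show ?case by (simp add: mon_eval_plus mon_deg_plus keys_plus_nat Agr_mult)
qed

lemma mval_vdeg: "is_xmon a \<Longrightarrow> n < length vs \<Longrightarrow> mval a \<noteq> 0 \<and> (vs ! n) (mval a) = vdeg n a"
proof (induction a rule: monomial_induct)
  case zero
  then show ?case by (simp add: valued_algebra.val_1[OF val_nth])
next
  case (var x)
  then obtain j where j: "x = Xv j" "j < length fs" by auto
  then show ?case using fs[of "fs ! j"] by (simp add: mon_deg_single val_weight_def)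
next
  case (add a b)
  then show ?case
    by (simp add: mon_eval_plus mon_deg_plus keys_plus_nat valued_algebra.val_mult[OF val_nth])
qed

lemma ev_restrict_eq:
  "ev (restrict_mons P h) = (\<Sum>a\<in>Poly_Mapping.keys h.
      if P a then scale (Poly_Mapping.lookup h a) (mval a) else 0)"
  unfolding eval_at_eq linear_sum_def
  by (rule sum.mono_neutral_cong_left) (auto simp: keys_restrict_mons lookup_restrict_mons)

text \<open>The sums, products and powers in \<open>beta\<close> are computed among finitely
  supported functions, where terms multiply by adding their degrees; the image is taken only at the
  end. For this every factor must lie in the subring on which \<open>Gr_proj\<close> is a
  homomorphism, which holds since each generator is placed in the degree of its own value.\<close>

lemma beta_eq:
  assumes n: "n < length vs" and h: "h \<in> carrier XR"
  shows "beta scale Agr (vs ! n) fs h = valued_algebra.Gr_proj (vs ! n)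
    (\<Sum>a\<in>Poly_Mapping.keys h. Poly_Mapping.single (ddeg a)
        (Poly_Mapping.single (vdeg n a) (scale (Poly_Mapping.lookup h a) (mval a))))"
proof -
  let ?v = "vs ! n"
  interpret valued_algebra scale ?v by (rule val_nth[OF n])
  let ?S = "\<lambda>\<delta> \<gamma> f. Poly_Mapping.single \<delta> (Poly_Mapping.single \<gamma> f) :: 'd \<Rightarrow>\<^sub>0 int \<Rightarrow>\<^sub>0 'b"
  let ?T = "{x :: 'd \<Rightarrow>\<^sub>0 int \<Rightarrow>\<^sub>0 'b.
    \<forall>\<delta> \<gamma>. Poly_Mapping.lookup (Poly_Mapping.lookup x \<delta>) \<gamma> \<in> F_ge ?v \<gamma>}"
  interpret R: ring_surjection ?T Gr_proj "gr_group_ring ?v" by (rule gr_group_ring_surjection)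
  have S_in: "?S \<delta> \<gamma> f \<in> ?T" if "f \<in> F_ge ?v \<gamma>" for \<delta> \<gamma> f
    using that by (auto simp: lookup_single when_def)
  have init: "initial_form_Delta Agr ?v f = Gr_proj (?S (degree_elem Agr f) (?v f) f)" for f
    by (simp add: initial_form_Delta_def initial_form_def Gr_proj_single)
  have const: "?S 0 0 (scale c 1) \<in> ?T" if "c \<noteq> 0" for c
    using that by (intro S_in) (simp add: F_ge_iff val_scalar)
  have gen: "?S (degree_elem Agr (fs ! j)) (?v (fs ! j)) (fs ! j) \<in> ?T" for j
    by (intro S_in) (simp add: F_ge_iff)
  have power: "?S \<delta> \<gamma> f ^ k = ?S (\<Sum>_<k. \<delta>) (\<Sum>_<k. \<gamma>) (f ^ k)" for \<delta> \<gamma> f and k :: nat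
    by (induction k) (simp_all add: mult_single algebra_simps)
  have prod: "(\<Prod>j\<in>J. ?S (d j) (g j) (x j)) = ?S (sum d J) (sum g J) (prod x J)"
    for J :: "nat set" and d g x
    by (induction J rule: infinite_finite_induct) (simp_all add: mult_single)
  have mon: "(\<Prod>j<length fs. ?S (degree_elem Agr (fs ! j)) (?v (fs ! j)) (fs ! j) ^ Poly_Mapping.lookup a (Xv j))
      = ?S (ddeg a) (vdeg n a) (mval a)" if "is_xmon a" for a
  proof -
    have inj: "inj_on Xv J" for J by (rule inj_onI) simp
    show ?thesis
      by (simp add: power prod mon_deg_superset[OF _ that] mon_eval_superset[OF _ that]
        sum.reindex[OF inj] prod.reindex[OF inj] Delta_weight_def val_weight_def)
  qed
  have T: "?S 0 0 (scale (Poly_Mapping.lookup h a) 1) * ?S (ddeg a) (vdeg n a) (mval a)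
      = ?S (ddeg a) (vdeg n a) (scale (Poly_Mapping.lookup h a) (mval a))" for a
    by (simp add: mult_single flip: scale_mult_left)
  have mon_in: "?S (ddeg a) (vdeg n a) (mval a) \<in> ?T" if "is_xmon a" for a
    unfolding mon[OF that, symmetric] by (intro R.T_prod R.T_power gen)
  have term_in: "?S (ddeg a) (vdeg n a) (scale (Poly_Mapping.lookup h a) (mval a)) \<in> ?T"
    if "a \<in> Poly_Mapping.keys h" for a
    unfolding T[symmetric]
    by (rule R.T_mult[OF const mon_in]) (use h that in \<open>auto simp: poly_ring_carrier_iff in_keys_iff\<close>)
  have "beta scale Agr ?v fs h = (\<Oplus>\<^bsub>gr_group_ring ?v\<^esub>a\<in>Poly_Mapping.keys h.
     Gr_proj (?S (ddeg a) (vdeg n a) (scale (Poly_Mapping.lookup h a) (mval a))))"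
    unfolding beta_def
  proof (intro abelian_monoid.finsum_cong' refl)
    interpret cring "gr_group_ring ?v :: ('d \<Rightarrow> int \<Rightarrow> 'b set) ring" by (rule R.cring)
    show "abelian_monoid (gr_group_ring ?v :: ('d \<Rightarrow> int \<Rightarrow> 'b set) ring)"
      by (rule abelian_monoid_axioms)
    fix a assume a: "a \<in> Poly_Mapping.keys h"
    then have x: "is_xmon a" and c: "Poly_Mapping.lookup h a \<noteq> 0"
      using h by (auto simp: poly_ring_carrier_iff in_keys_iff)
    show "pure_tensor (gr_ring ?v) (gr_class ?v 0 (scale (Poly_Mapping.lookup h a) 1)) 0
        \<otimes>\<^bsub>gr_group_ring ?v\<^esub>
        (\<Otimes>\<^bsub>gr_group_ring ?v\<^esub>j\<in>{..<length fs}.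
           initial_form_Delta Agr ?v (fs ! j) [^]\<^bsub>gr_group_ring ?v\<^esub> Poly_Mapping.lookup a (Xv j))
      = Gr_proj (?S (ddeg a) (vdeg n a) (scale (Poly_Mapping.lookup h a) (mval a)))"
      unfolding init T[symmetric] R.hom_mult[OF const[OF c] mon_in[OF x]]
      unfolding mon[OF x, symmetric] R.hom_prod[OF finite_lessThan R.T_power[OF gen]]
        R.hom_power[OF gen] Gr_proj_single[of 0 0]
      by (rule refl)
  qed (auto intro: R.hom_closed[OF term_in])
  also have "\<dots> = Gr_proj (\<Sum>a\<in>Poly_Mapping.keys h.
      ?S (ddeg a) (vdeg n a) (scale (Poly_Mapping.lookup h a) (mval a)))"
    by (rule R.hom_sum[OF finite_keys term_in, symmetric])
  finally show ?thesis .
qed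

text \<open>Distinct pairs of degrees occupy distinct places of the graded group ring, so the kernel
  condition splits: the terms sharing a pair of degrees must cancel to a value above their common
  degree.\<close>

lemma ideal_J_iff:
  assumes n: "n < length vs"
  shows "h \<in> ideal_J scale Agr (vs ! n) fs \<longleftrightarrow> h \<in> carrier XR \<and>
    (\<forall>\<delta> \<gamma>. ev (restrict_mons (\<lambda>a. ddeg a = \<delta> \<and> vdeg n a = \<gamma>) h) \<in> F_gt (vs ! n) \<gamma>)"
proof (cases "h \<in> carrier XR")
  case True
  interpret valued_algebra scale "vs ! n" by (rule val_nth[OF n])
  have "Poly_Mapping.lookup (Poly_Mapping.lookup (\<Sum>a\<in>Poly_Mapping.keys h. Poly_Mapping.single (ddeg a)
        (Poly_Mapping.single (vdeg n a) (scale (Poly_Mapping.lookup h a) (mval a)))) \<delta>) \<gamma>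
      = ev (restrict_mons (\<lambda>a. ddeg a = \<delta> \<and> vdeg n a = \<gamma>) h)" for \<delta> \<gamma>
    unfolding ev_restrict_eq lookup_sum by (rule sum.cong) (auto simp: lookup_single when_def)
  then show ?thesis using True
    by (simp add: ideal_J_def beta_eq[OF n True] Gr_proj_eq_0_iff)
qed (simp add: ideal_J_def)

end

section \<open>The Rees filtration\<close>

text \<open>
  \<open>filt scale vs G d f\<close>: \<open>f\<close> is a linear combination of products of elements of \<open>G\<close> whose sum of
  \<open>i\<close>-th valuations is at least \<open>d i\<close> for every \<open>i\<close>. Faithful representability of \<open>f\<close> is the case
  \<open>d i = (vs ! i) f\<close>, and this form does not refer to an enumeration of \<open>G\<close>.
\<close>

inductive filt ::
  "('k::field \<Rightarrow> 'b::idom \<Rightarrow> 'b) \<Rightarrow> ('b \<Rightarrow> int) list \<Rightarrow> 'b set \<Rightarrow> (nat \<Rightarrow> int) \<Rightarrow> 'b \<Rightarrow> bool"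
  for scale vs G where
  scalar: "c = 0 \<or> (\<forall>n<length vs. d n \<le> 0) \<Longrightarrow> filt scale vs G d (scale c 1)"
| gen: "g \<in> G \<Longrightarrow> \<forall>n<length vs. d n \<le> (vs ! n) g \<Longrightarrow> filt scale vs G d g"
| add: "filt scale vs G d f \<Longrightarrow> filt scale vs G d g \<Longrightarrow> filt scale vs G d (f + g)"
| mult: "filt scale vs G d f \<Longrightarrow> filt scale vs G e g \<Longrightarrow> \<forall>n<length vs. r n \<le> d n + e n
    \<Longrightarrow> filt scale vs G r (f * g)"

lemma filt_antimono:
  "filt scale vs G d f \<Longrightarrow> \<forall>n<length vs. e n \<le> d n \<Longrightarrow> filt scale vs G e f"
proof (induction arbitrary: e rule: filt.induct)
  case (scalar c d)
  then show ?case by (intro filt.scalar) force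
next
  case (gen g d)
  then show ?case by (intro filt.gen) force+
next
  case (mult d f e' g r)
  show ?case by (rule filt.mult[OF mult.hyps(1,2)]) (use mult in force)
qed (auto intro: filt.add)

text \<open>Transitivity of faithful representability. It turns a representation over a given MUVAK
  basis into one over the current generators.\<close>

lemma filt_generators:
  assumes "filt scale vs G d f"
    and "\<And>g. g \<in> G \<Longrightarrow> filt scale vs H (\<lambda>n. (vs ! n) g) g"
  shows "filt scale vs H d f"
  using assms(1)
proof (induction rule: filt.induct)
  case (gen g d)
  then show ?case by (intro filt_antimono[OF assms(2)]) auto
qed (auto intro: filt.intros)

lemma filt_mono:
  assumes "filt scale vs G d f" "G \<subseteq> H"
  shows "filt scale vs H d f"
  by (rule filt_generators[OF assms(1)]) (use assms(2) in \<open>auto intro: filt.gen\<close>)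

context comm_algebra
begin

lemma filt_zero [simp]: "filt scale vs G d 0"
  using filt.scalar[of 0 vs d scale G] by simp

lemma filt_scale:
  assumes "filt scale vs G d f" shows "filt scale vs G d (scale c f)"
proof -
  have "filt scale vs G (\<lambda>_. 0) (scale c 1)" by (rule filt.scalar) simp
  then have "filt scale vs G d (scale c 1 * f)"
    by (rule filt.mult[OF _ assms]) simp
  then show ?thesis by (metis scale_conv_mult)
qed

lemma filt_one: "\<forall>n<length vs. d n \<le> 0 \<Longrightarrow> filt scale vs G d 1"
  using filt.scalar[of 1 vs d scale G] by simp

lemma filt_sum: "(\<And>i. i \<in> I \<Longrightarrow> filt scale vs G d (f i)) \<Longrightarrow> filt scale vs G d (sum f I)"
  by (induction I rule: infinite_finite_induct) (auto intro: filt.add)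

end

section \<open>The Rees algebra of the multidegree filtration\<close>

context generators
begin

definition has_vdeg :: "(nat \<Rightarrow> int) \<Rightarrow> (mvar \<Rightarrow>\<^sub>0 nat) \<Rightarrow> bool" where
  "has_vdeg d a \<longleftrightarrow> (\<forall>n<length vs. vdeg n a = d n)"

definition vdeg_ge :: "(nat \<Rightarrow> int) \<Rightarrow> 'k mpoly \<Rightarrow> bool" where
  "vdeg_ge d u \<longleftrightarrow> (\<forall>a\<in>Poly_Mapping.keys u. \<forall>n<length vs. d n \<le> vdeg n a)"

text \<open>
  The ring in the variables \<open>Xv j\<close> and \<open>Tv i\<close> is the Rees algebra of the filtration \<^term>\<open>vdeg_ge\<close>:
  dehomogenization identifies the component of multidegree \<open>d\<close> with the polynomials \<open>u\<close> satisfying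
  \<^term>\<open>vdeg_ge d u\<close>, and \<open>lift_to d\<close> is the inverse.
\<close>

definition component :: "(nat \<Rightarrow> int) \<Rightarrow> 'k mpoly \<Rightarrow> 'k mpoly" where
  "component d p = deh (restrict_mons (has_vdeg d) p)"

text \<open>Since \<open>Tv n\<close> has degree -1 in the \<open>n\<close>-th grading and 0 in the
  others, these exponents bring \<open>a\<close> down to multidegree \<open>d\<close>. No truncation
  by \<open>nat\<close> occurs as long as \<open>d n \<le> vdeg n a\<close>.\<close>

definition t_mon :: "(nat \<Rightarrow> int) \<Rightarrow> (mvar \<Rightarrow>\<^sub>0 nat) \<Rightarrow> mvar \<Rightarrow>\<^sub>0 nat" where
  "t_mon d a = (\<Sum>n<length vs. Poly_Mapping.single (Tv n) (nat (vdeg n a - d n)))"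

definition lift_to :: "(nat \<Rightarrow> int) \<Rightarrow> 'k mpoly \<Rightarrow> 'k mpoly" where
  "lift_to d u = linear_sum (\<lambda>a c. Poly_Mapping.single (a + t_mon d a) c) u"

abbreviation bump :: "nat \<Rightarrow> (nat \<Rightarrow> int) \<Rightarrow> nat \<Rightarrow> int" where
  "bump i d \<equiv> d(i := d i + 1)"

abbreviation "is_xtmon a \<equiv> Poly_Mapping.keys a \<subseteq> Xv ` {..<length fs} \<union> Tv ` {..<length vs}"

lemma val_weight_T: "val_weight vs fs n (Tv i) = (if n = i then - 1 else 0)"
  by (simp add: val_weight_def)

lemma vdeg_T_sum:
  assumes "n < length vs"
  shows "vdeg n (\<Sum>k<length vs. Poly_Mapping.single (Tv k) (e k)) = - int (e n)"
proof -
  have "vdeg n (\<Sum>k<length vs. Poly_Mapping.single (Tv k) (e k))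
      = (\<Sum>k<length vs. if n = k then - int (e k) else 0)"
    unfolding mon_deg_sum by (rule sum.cong) (auto simp: mon_deg_single val_weight_T)
  also have "\<dots> = - int (e n)" using assms by simp
  finally show ?thesis .
qed

lemma vdeg_x_part: "vdeg n a = vdeg n (x_part a) - int (Poly_Mapping.lookup a (Tv n))"
proof (induction a rule: monomial_induct)
  case (var x)
  then show ?case
    by (cases x) (auto simp: x_part_single mon_deg_single val_weight_T lookup_single when_def)
qed (simp_all add: mon_deg_plus x_part_plus lookup_add)

lemma ddeg_x_part: "ddeg (x_part a) = ddeg a"
proof (induction a rule: monomial_induct)
  case (var x)
  then show ?case by (cases x) (auto simp: x_part_single mon_deg_single Delta_weight_def)
qed (simp_all add: mon_deg_plus x_part_plus)

lemma lookup_t_mon: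
  "Poly_Mapping.lookup (t_mon d a) (Xv j) = 0"
  "Poly_Mapping.lookup (t_mon d a) (Tv k) = (if k < length vs then nat (vdeg k a - d k) else 0)"
  by (simp_all add: t_mon_def lookup_sum lookup_single when_def)

lemma x_part_t_mon [simp]: "x_part (t_mon d a) = 0"
  by (simp add: t_mon_def x_part_sum x_part_single)

lemma keys_t_mon: "Poly_Mapping.keys (t_mon d a) \<subseteq> Tv ` {..<length vs}"
proof
  show "x \<in> Tv ` {..<length vs}" if "x \<in> Poly_Mapping.keys (t_mon d a)" for x
    using that by (cases x) (auto simp: in_keys_iff lookup_t_mon split: if_splits)
qed

lemma has_vdeg_t_mon:
  assumes "\<forall>n<length vs. d n \<le> vdeg n a"
  shows "has_vdeg d (a + t_mon d a)"
  unfolding has_vdeg_def mon_deg_plus t_mon_def using assms by (simp add: vdeg_T_sum)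

text \<open>In a fixed multidegree the exponents of the \<open>Tv k\<close> are forced by the
  remaining part of the monomial, so setting them to 1 loses nothing.\<close>

lemma x_part_plus_t_mon:
  assumes "has_vdeg d a" "is_xtmon a"
  shows "x_part a + t_mon d (x_part a) = a"
proof (rule poly_mapping_mvar_eqI)
  fix k
  have "nat (vdeg k (x_part a) - d k) = Poly_Mapping.lookup a (Tv k)" if "k < length vs"
    using vdeg_x_part[of k a] assms(1) that by (simp add: has_vdeg_def)
  moreover have "Poly_Mapping.lookup a (Tv k) = 0" if "\<not> k < length vs"
  proof -
    have "Tv k \<notin> Poly_Mapping.keys a" using assms(2) that by auto
    then show ?thesis by (simp add: in_keys_iff)
  qed
  ultimately show "Poly_Mapping.lookup (x_part a + t_mon d (x_part a)) (Tv k) = Poly_Mapping.lookup a (Tv k)"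
    by (simp add: lookup_add lookup_x_part lookup_t_mon)
qed (simp add: lookup_add lookup_x_part lookup_t_mon)

lemma is_xmon_x_part: "is_xtmon a \<Longrightarrow> is_xmon (x_part a)"
  by (auto simp: keys_x_part)

lemma x_part_xmon: "is_xmon a \<Longrightarrow> x_part a = a"
  by (rule x_part_id) auto

lemma keys_linear_sum_single:
  "Poly_Mapping.keys (linear_sum (\<lambda>a c. Poly_Mapping.single (f a) c) u) \<subseteq> f ` Poly_Mapping.keys u"
proof -
  have "Poly_Mapping.keys (\<Sum>a\<in>Poly_Mapping.keys u. Poly_Mapping.single (f a) (Poly_Mapping.lookup u a))
      \<subseteq> (\<Union>a\<in>Poly_Mapping.keys u. Poly_Mapping.keys (Poly_Mapping.single (f a) (Poly_Mapping.lookup u a)))"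
    by (rule keys_sum)
  then show ?thesis by (auto simp: linear_sum_def split: if_splits)
qed

lemma deh_carrier:
  assumes "p \<in> carrier XTR" shows "deh p \<in> carrier XR"
  using assms keys_linear_sum_single[of x_part p] is_xmon_x_part
  unfolding deh_eq poly_ring_carrier_iff by blast

lemma vdeg_ge_deh:
  assumes "\<And>a. a \<in> Poly_Mapping.keys p \<Longrightarrow> has_vdeg d a"
  shows "vdeg_ge d (deh p)"
proof -
  have "d n \<le> vdeg n (x_part a)" if "a \<in> Poly_Mapping.keys p" "n < length vs" for a n
    using assms[OF that(1)] that(2) vdeg_x_part[of n a] by (simp add: has_vdeg_def)
  then show ?thesis
    using keys_linear_sum_single[of x_part p] unfolding deh_eq vdeg_ge_def by blast
qed

lemma vdeg_ge_component: "vdeg_ge d (component d p)"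
  unfolding component_def by (rule vdeg_ge_deh) (simp add: keys_restrict_mons)

lemma component_zero [simp]: "component d 0 = 0"
  by (simp add: component_def)

lemma component_add: "component d (p + q) = component d p + component d q"
  by (simp add: component_def restrict_mons_add deh_add)

lemma component_single_times:
  "component d (Poly_Mapping.single b c * p)
    = Poly_Mapping.single (x_part b) c * component (\<lambda>n. d n - vdeg n b) p"
proof -
  have "has_vdeg d (b + a) = has_vdeg (\<lambda>n. d n - vdeg n b) a" for a
    by (auto simp: has_vdeg_def mon_deg_plus)
  then show ?thesis
    by (simp add: component_def restrict_mons_single_times deh_single_times)
qed

lemma lift_to_zero [simp]: "lift_to d 0 = 0"
  by (simp add: lift_to_def)

lemma lift_to_add: "lift_to d (p + q) = lift_to d p + lift_to d q"
  unfolding lift_to_def by (rule linear_sum_add) (simp_all add: single_add)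

lemma lift_to_single: "lift_to d (Poly_Mapping.single a c) = Poly_Mapping.single (a + t_mon d a) c"
  by (simp add: lift_to_def linear_sum_single)

lemma keys_lift_to: "Poly_Mapping.keys (lift_to d u) \<subseteq> (\<lambda>a. a + t_mon d a) ` Poly_Mapping.keys u"
  unfolding lift_to_def by (rule keys_linear_sum_single)

lemma lift_to_carrier:
  assumes "u \<in> carrier XR" shows "lift_to d u \<in> carrier XTR"
proof -
  have "Poly_Mapping.keys (a + t_mon d a) \<subseteq> Xv ` {..<length fs} \<union> Tv ` {..<length vs}"
    if "a \<in> Poly_Mapping.keys u" for a
    using assms keys_t_mon[of d a] that by (auto simp: poly_ring_carrier_iff keys_plus_nat)
  then show ?thesis
    using keys_lift_to[of d u] by (auto simp: poly_ring_carrier_iff dest!: subsetD)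
qed

lemma deh_lift_to:
  assumes "u \<in> carrier XR" shows "deh (lift_to d u) = u"
proof (rule poly_mapping_sum_induct[of "\<lambda>u. deh (lift_to d u) = u"])
  fix a c assume "a \<in> Poly_Mapping.keys u"
  then have "is_xmon a" using assms by (simp add: poly_ring_carrier_iff)
  then show "deh (lift_to d (Poly_Mapping.single a c)) = Poly_Mapping.single a c"
    by (simp add: lift_to_single deh_single x_part_plus x_part_xmon)
qed (simp_all add: lift_to_add deh_add)

lemma lift_to_deh:
  assumes "p \<in> carrier XTR" "\<And>a. a \<in> Poly_Mapping.keys p \<Longrightarrow> has_vdeg d a"
  shows "lift_to d (deh p) = p"
proof (rule poly_mapping_sum_induct[of "\<lambda>p. lift_to d (deh p) = p"])
  fix a c assume "a \<in> Poly_Mapping.keys p"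
  then have "is_xtmon a" "has_vdeg d a" using assms by (auto simp: poly_ring_carrier_iff)
  then show "lift_to d (deh (Poly_Mapping.single a c)) = Poly_Mapping.single a c"
    by (simp add: deh_single lift_to_single x_part_plus_t_mon)
qed (simp_all add: lift_to_add deh_add)

lemma has_vdeg_lift_to:
  assumes "vdeg_ge e u" "a \<in> Poly_Mapping.keys (lift_to e u)"
  shows "has_vdeg e a"
proof -
  obtain b where "b \<in> Poly_Mapping.keys u" "a = b + t_mon e b"
    using assms(2) keys_lift_to[of e u] by blast
  then show ?thesis using assms(1) has_vdeg_t_mon[of e b] by (simp add: vdeg_ge_def)
qed

text \<open>Multidegrees are functions on all natural numbers, but only the values below
  \<open>length vs\<close> count; hence the comparison of these values instead of
  \<open>d = e\<close>.\<close>

lemma component_homogeneous: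
  assumes "\<And>a. a \<in> Poly_Mapping.keys p \<Longrightarrow> has_vdeg e a"
  shows "component d p = (if \<forall>n<length vs. d n = e n then deh p else 0)"
proof (cases "\<forall>n<length vs. d n = e n")
  case True
  then have "restrict_mons (has_vdeg d) p = p"
    using assms by (intro restrict_mons_id) (simp add: has_vdeg_def)
  with True show ?thesis by (simp add: component_def)
next
  case False
  then have "restrict_mons (has_vdeg d) p = 0"
    using assms by (intro restrict_mons_empty) (force simp: has_vdeg_def)
  then show ?thesis unfolding if_not_P[OF False] by (simp add: component_def)
qed

lemma component_lift_to:
  assumes "u \<in> carrier XR" "vdeg_ge e u"
  shows "component d (lift_to e u) = (if \<forall>n<length vs. d n = e n then u else 0)"
proof -
  have "component d (lift_to e u) = (if \<forall>n<length vs. d n = e n then deh (lift_to e u) else 0)"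
    by (rule component_homogeneous) (rule has_vdeg_lift_to[OF assms(2)])
  then show ?thesis unfolding deh_lift_to[OF assms(1)] .
qed

text \<open>Inside the Rees algebra, the inclusion of one step of the filtration into a larger one
  is multiplication by a monomial in the \<open>Tv n\<close>.\<close>

lemma lift_to_lower:
  assumes "vdeg_ge e u" "\<forall>n<length vs. d n \<le> e n"
  shows "lift_to d u
    = Poly_Mapping.single (\<Sum>n<length vs. Poly_Mapping.single (Tv n) (nat (e n - d n))) 1 * lift_to e u"
  unfolding lift_to_def linear_sum_def sum_distrib_left
proof (rule sum.cong[OF refl])
  fix a assume a: "a \<in> Poly_Mapping.keys u"
  have "t_mon d a = (\<Sum>n<length vs. Poly_Mapping.single (Tv n) (nat (e n - d n))) + t_mon e a"
    unfolding t_mon_def sum.distrib[symmetric]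
  proof (rule sum.cong[OF refl])
    fix n assume "n \<in> {..<length vs}"
    then have "nat (vdeg n a - d n) = nat (e n - d n) + nat (vdeg n a - e n)"
      using assms a by (simp add: vdeg_ge_def flip: nat_add_distrib)
    then show "Poly_Mapping.single (Tv n) (nat (vdeg n a - d n)) =
        Poly_Mapping.single (Tv n) (nat (e n - d n)) + Poly_Mapping.single (Tv n) (nat (vdeg n a - e n))"
      by (simp flip: single_add)
  qed
  then show "Poly_Mapping.single (a + t_mon d a) (Poly_Mapping.lookup u a) =
      Poly_Mapping.single (\<Sum>n<length vs. Poly_Mapping.single (Tv n) (nat (e n - d n))) 1 *
      Poly_Mapping.single (a + t_mon e a) (Poly_Mapping.lookup u a)"
    by (simp add: mult_single ac_simps)
qed

text \<open>A gain of one in the \<open>i\<close>-th degree is divisibility by \<open>Tv i\<close>.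
  This is why the test of the algorithm adds the ideal of that variable.\<close>

lemma lift_to_bump:
  assumes "i < length vs" "vdeg_ge (bump i d) u"
  shows "lift_to d u = Var (Tv i) * lift_to (bump i d) u"
proof -
  have "(\<Sum>n<length vs. Poly_Mapping.single (Tv n) (nat (bump i d n - d n)))
      = (\<Sum>n<length vs. if n = i then Poly_Mapping.single (Tv i) 1 else 0)"
    by (rule sum.cong) auto
  also have "\<dots> = Poly_Mapping.single (Tv i) 1"
    using assms(1) by simp
  finally show ?thesis
    using lift_to_lower[OF assms(2), of d] by (simp add: Var_def)
qed

text \<open>For nonzero \<open>h\<close> the minima form the largest multidegree that bounds all
  terms from below. The lifts to smaller multidegrees are multiples of this one.\<close>

lemma hom_poly_eq_lift_to: "hom_poly vs fs h = lift_to (\<lambda>n. Min (vdeg n ` Poly_Mapping.keys h)) h"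
proof -
  have var: "Var x ^ k = Poly_Mapping.single (Poly_Mapping.single x k) (1 :: 'k)" for x k
    by (induction k) (simp_all add: Var_def mult_single flip: single_add)
  have "(\<Prod>i\<in>J. Var (Tv i) ^ e i) = Poly_Mapping.single (\<Sum>i\<in>J. Poly_Mapping.single (Tv i) (e i)) (1 :: 'k)"
    for e and J :: "nat set"
    by (induction J rule: infinite_finite_induct) (simp_all add: var mult_single)
  then show ?thesis
    by (simp add: hom_poly_def lift_to_def linear_sum_def t_mon_def mult_single)
qed

lemma vdeg_ge_Min: "vdeg_ge (\<lambda>n. Min (vdeg n ` Poly_Mapping.keys h)) h"
  by (simp add: vdeg_ge_def)

lemma hom_poly_carrier: "h \<in> carrier XR \<Longrightarrow> hom_poly vs fs h \<in> carrier XTR"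
  by (simp add: hom_poly_eq_lift_to lift_to_carrier)

lemma hom_ideal_ideal:
  assumes "\<aa> \<subseteq> carrier XR" shows "ideal (hom_ideal vs fs \<aa>) XTR"
proof -
  interpret cring XTR by (rule cring_poly_ring)
  show ?thesis unfolding hom_ideal_def
    by (rule genideal_ideal) (use assms hom_poly_carrier in auto)
qed

lemma lift_to_in_hom_ideal:
  assumes "\<aa> \<subseteq> carrier XR" "u \<in> \<aa>" "vdeg_ge d u"
  shows "lift_to d u \<in> hom_ideal vs fs \<aa>"
proof (cases "u = 0")
  \<comment> \<open>For \<open>u = 0\<close> the minima are taken over the empty set and carry no
    information.\<close>
  case True
  then show ?thesis using hom_ideal_ideal[OF assms(1)] by (simp add: poly_ring_ideal_iff)
next
  case False
  interpret cring XTR by (rule cring_poly_ring)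
  let ?e = "\<lambda>n. Min (vdeg n ` Poly_Mapping.keys u)"
  let ?t = "\<Sum>n<length vs. Poly_Mapping.single (Tv n) (nat (?e n - d n)) :: mvar \<Rightarrow>\<^sub>0 nat"
  have "hom_poly vs fs u \<in> hom_ideal vs fs \<aa>"
    unfolding hom_ideal_def
    using genideal_self[of "hom_poly vs fs ` \<aa>"] assms hom_poly_carrier by blast
  moreover have "Poly_Mapping.keys ?t \<subseteq> Tv ` {..<length vs}"
    using keys_sum[of "\<lambda>n. Poly_Mapping.single (Tv n) (nat (?e n - d n))" "{..<length vs}"]
    by (auto split: if_splits)
  then have "Poly_Mapping.single ?t 1 \<in> carrier XTR"
    by (auto simp: poly_ring_carrier_iff)
  ultimately have "Poly_Mapping.single ?t 1 * hom_poly vs fs u \<in> hom_ideal vs fs \<aa>"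
    using hom_ideal_ideal[OF assms(1)] by (simp add: poly_ring_ideal_iff)
  moreover have "\<forall>n<length vs. d n \<le> ?e n"
    using False assms(3) by (simp add: vdeg_ge_def)
  ultimately show ?thesis
    using lift_to_lower[OF vdeg_ge_Min, of d u] by (simp add: hom_poly_eq_lift_to)
qed

text \<open>An ideal can be bounded from above by prescribing where its dehomogenized components
  lie. \<open>Q d\<close> will be membership in \<open>J_i\<close>, or the requirement that the
  value lies in a step of the filtration depending on \<open>d\<close>.\<close>

lemma graded_ideal:
  assumes zero: "\<And>d. Q d 0" and add: "\<And>d u w. Q d u \<Longrightarrow> Q d w \<Longrightarrow> Q d (u + w)"
    and mult: "\<And>d b c u. is_xtmon b \<Longrightarrow> Q (\<lambda>n. d n - vdeg n b) u \<Longrightarrow> Q d (Poly_Mapping.single (x_part b) c * u)"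
  shows "ideal {p \<in> carrier XTR. \<forall>d. Q d (component d p)} XTR"
  unfolding poly_ring_ideal_iff
proof (intro conjI ballI)
  let ?S = "{p \<in> carrier XTR. \<forall>d. Q d (component d p)}"
  show "?S \<subseteq> carrier XTR" by blast
  show S0: "0 \<in> ?S" by (simp add: zero poly_ring_closed)
  show S_add: "p + q \<in> ?S" if "p \<in> ?S" "q \<in> ?S" for p q
    using that by (simp add: component_add add poly_ring_closed)
  fix q p assume q: "q \<in> carrier XTR" and p: "p \<in> ?S"
  show "q * p \<in> ?S"
  proof (rule poly_mapping_sum_induct[of "\<lambda>q. q * p \<in> ?S"])
    fix b c assume "b \<in> Poly_Mapping.keys q"
    then have "is_xtmon b" using q by (auto simp: poly_ring_carrier_iff)
    moreover from this have "Poly_Mapping.single b c \<in> carrier XTR"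
      by (simp add: poly_ring_carrier_iff)
    ultimately show "Poly_Mapping.single b c * p \<in> ?S"
      using p by (simp add: component_single_times mult poly_ring_closed)
  next
    fix r s assume "r * p \<in> ?S" "s * p \<in> ?S"
    then show "(r + s) * p \<in> ?S"
      using S_add unfolding distrib_right by blast
  qed (simp add: S0[simplified])
qed

text \<open>A homogenized polynomial has at most one nonzero component, which dehomogenizes to the
  polynomial itself. Its multidegree varies with the polynomial, so \<open>Q d u\<close> is required
  for every \<open>d\<close>.\<close>

lemma hom_ideal_subset:
  assumes "\<aa> \<subseteq> carrier XR" "ideal {p \<in> carrier XTR. \<forall>d. Q d (component d p)} XTR"
    and "\<And>d. Q d 0" "\<And>d u. u \<in> \<aa> \<Longrightarrow> Q d u"
  shows "hom_ideal vs fs \<aa> \<subseteq> {p \<in> carrier XTR. \<forall>d. Q d (component d p)}"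
proof -
  interpret cring XTR by (rule cring_poly_ring)
  show ?thesis
    unfolding hom_ideal_def
  proof (rule genideal_minimal[OF assms(2)], safe)
    fix u d assume "u \<in> \<aa>"
    with assms(1) have u: "u \<in> carrier XR" by blast
    then show "hom_poly vs fs u \<in> carrier XTR" by (rule hom_poly_carrier)
    show "Q d (component d (hom_poly vs fs u))"
      using assms(3,4) \<open>u \<in> \<aa>\<close>
      by (simp add: hom_poly_eq_lift_to component_lift_to[OF u vdeg_ge_Min])
  qed
qed

section \<open>Elements of the filtration and polynomials representing them\<close>

lemma filt_mval:
  assumes "set fs \<subseteq> G"
  shows "is_xmon a \<Longrightarrow> filt scale vs G (\<lambda>n. vdeg n a) (mval a)"
proof (induction a rule: monomial_induct)
  case zero
  then show ?case by (simp add: filt_one)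
next
  case (var x)
  then obtain j where "x = Xv j" "j < length fs" by auto
  with assms show ?case
    by (auto simp: mon_deg_single val_weight_def intro!: filt.gen)
next
  case (add a b)
  then show ?case
    unfolding mon_eval_plus by (intro filt.mult[of _ _ _ "\<lambda>n. vdeg n a" _ "\<lambda>n. vdeg n b"])
      (auto simp: mon_deg_plus keys_plus_nat)
qed

lemma filt_ev:
  assumes "set fs \<subseteq> G" "u \<in> carrier XR" "vdeg_ge d u"
  shows "filt scale vs G d (ev u)"
  unfolding eval_at_eq linear_sum_def
proof (intro filt_sum filt_scale)
  fix a assume "a \<in> Poly_Mapping.keys u"
  then show "filt scale vs G d (mval a)"
    using assms by (intro filt_antimono[OF filt_mval[OF assms(1)]])
      (auto simp: poly_ring_carrier_iff vdeg_ge_def)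
qed

lemma vdeg_ge_add: "vdeg_ge d u \<Longrightarrow> vdeg_ge d w \<Longrightarrow> vdeg_ge d (u + w)"
  using keys_add[of u w] unfolding vdeg_ge_def by blast

text \<open>Converse of \<open>filt_ev\<close>: a derivation of \<open>filt\<close> is replayed with
  polynomials, where degrees of factors add up.\<close>

lemma filt_imp_poly:
  assumes "filt scale vs (set fs) d f"
  shows "\<exists>h\<in>carrier XR. ev h = f \<and> vdeg_ge d h"
  using assms
proof (induction rule: filt.induct)
  case (scalar c d)
  then show ?case
    by (intro bexI[of _ "Poly_Mapping.single 0 c"])
      (auto simp: eval_at_const vdeg_ge_def poly_ring_carrier_iff)
next
  case (gen g d)
  then obtain j where j: "j < length fs" "g = fs ! j" by (metis in_set_conv_nth)
  with gen show ?case
    by (intro bexI[of _ "Var (Xv j)"])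
      (auto simp: eval_at_single vdeg_ge_def poly_ring_carrier_iff Var_def mon_deg_single val_weight_def)
next
  case (add d f g)
  then obtain u w where "u \<in> carrier XR" "ev u = f" "vdeg_ge d u" "w \<in> carrier XR" "ev w = g" "vdeg_ge d w"
    by blast
  then show ?case
    by (intro bexI[of _ "u + w"]) (auto simp: eval_at_add vdeg_ge_add poly_ring_closed)
next
  case (mult d f e g r)
  then obtain u w where uw: "u \<in> carrier XR" "ev u = f" "vdeg_ge d u" "w \<in> carrier XR" "ev w = g" "vdeg_ge e w"
    by blast
  have "r n \<le> vdeg n a" if a: "a \<in> Poly_Mapping.keys (u * w)" and n: "n < length vs" for a n
  proof -
    obtain x y where "a = x + y" "x \<in> Poly_Mapping.keys u" "y \<in> Poly_Mapping.keys w"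
      using a keys_mult[of u w] by blast
    moreover from this have "d n \<le> vdeg n x" "e n \<le> vdeg n y"
      using uw n by (auto simp: vdeg_ge_def)
    moreover have "r n \<le> d n + e n" using mult.hyps(3) n by blast
    ultimately show ?thesis by (simp add: mon_deg_plus)
  qed
  then have "vdeg_ge r (u * w)" by (simp add: vdeg_ge_def)
  with uw show ?case
    by (intro bexI[of _ "u * w"]) (auto simp: eval_at_times poly_ring_closed)
qed

lemma ev_F_ge:
  assumes "n < length vs" "h \<in> carrier XR" "\<And>a. a \<in> Poly_Mapping.keys h \<Longrightarrow> \<gamma> \<le> vdeg n a"
  shows "ev h \<in> F_ge (vs ! n) \<gamma>"
proof -
  interpret valued_algebra scale "vs ! n" by (rule val_nth[OF assms(1)])
  show ?thesis
    unfolding eval_at_eq linear_sum_def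
  proof (rule F_ge_sum)
    fix a assume a: "a \<in> Poly_Mapping.keys h"
    then have "is_xmon a" "Poly_Mapping.lookup h a \<noteq> 0"
      using assms by (auto simp: poly_ring_carrier_iff in_keys_iff)
    then show "scale (Poly_Mapping.lookup h a) (mval a) \<in> F_ge (vs ! n) \<gamma>"
      using mval_vdeg[of a n] assms a by (auto simp: F_ge_iff val_scale)
  qed
qed

lemma ev_Agr:
  assumes "h \<in> carrier XR" "\<And>a. a \<in> Poly_Mapping.keys h \<Longrightarrow> ddeg a = \<delta>"
  shows "ev h \<in> Agr \<delta>"
  unfolding eval_at_eq linear_sum_def
  using assms mval_ddeg
  by (intro subspace_sum[OF Agr_subspace] subspace_scale[OF Agr_subspace]) (force simp: poly_ring_carrier_iff)

text \<open>The parts of \<open>h\<close> of other Delta-degrees have total value zero by uniqueness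
  of the homogeneous decomposition, so a representation of a homogeneous element may be assumed
  homogeneous.\<close>

lemma ev_ddeg_part:
  assumes "h \<in> carrier XR" "ev h \<in> Agr \<delta>"
  shows "ev (restrict_mons (\<lambda>a. ddeg a = \<delta>) h) = ev h"
proof -
  let ?h = "\<lambda>\<delta>. restrict_mons (\<lambda>a. ddeg a = \<delta>) h"
  let ?D = "(\<lambda>a. ddeg a) ` Poly_Mapping.keys h"
  have sum: "(\<Sum>\<epsilon>\<in>?D. ev (?h \<epsilon>)) = ev h"
    by (simp add: sum_restrict_mons_fibers flip: eval_at_sum)
  have "(\<Sum>\<epsilon>\<in>?D. ev (?h \<epsilon>)) = (if \<delta> \<in> ?D then ev (?h \<delta>) else 0)"
    by (rule Agr_sum_unique)
      (use assms sum in \<open>auto intro!: ev_Agr restrict_mons_carrier simp: keys_restrict_mons\<close>)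
  moreover have "?h \<delta> = 0" if "\<delta> \<notin> ?D"
    using that by (intro restrict_mons_empty) auto
  ultimately show ?thesis using sum by auto
qed

end

section \<open>Ideal membership and improved representations\<close>

context generators
begin

lemma ideal_J_carrier: "ideal_J scale Agr v fs \<subseteq> carrier XR"
  by (auto simp: ideal_J_def)

lemma ideal_I_carrier: "ideal_I scale fs \<subseteq> carrier XR"
  by (auto simp: ideal_I_def)

lemma ideal_J_zero:
  assumes "n < length vs" shows "0 \<in> ideal_J scale Agr (vs ! n) fs"
  by (simp add: ideal_J_iff[OF assms] poly_ring_closed F_gt_def)

lemma ideal_J_add:
  assumes n: "n < length vs" and "g \<in> ideal_J scale Agr (vs ! n) fs" "h \<in> ideal_J scale Agr (vs ! n) fs"
  shows "g + h \<in> ideal_J scale Agr (vs ! n) fs"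
proof -
  interpret valued_algebra scale "vs ! n" by (rule val_nth[OF n])
  show ?thesis
    using assms(2,3) unfolding ideal_J_iff[OF n] restrict_mons_add eval_at_add F_gt_eq_F_ge
    by (blast intro: F_ge_add poly_ring_closed)
qed

text \<open>Multiplication by a monomial raises the degree and the value by the same amount, so the
  excess of the value over the degree persists.\<close>

lemma ideal_J_single_times:
  assumes n: "n < length vs" and h: "h \<in> ideal_J scale Agr (vs ! n) fs" and b: "is_xmon b"
  shows "Poly_Mapping.single b c * h \<in> ideal_J scale Agr (vs ! n) fs"
proof -
  interpret valued_algebra scale "vs ! n" by (rule val_nth[OF n])
  have "ev (restrict_mons (\<lambda>a. ddeg a = \<delta> \<and> vdeg n a = \<gamma>) (Poly_Mapping.single b c * h)) \<in> F_gt (vs ! n) \<gamma>"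
    for \<delta> \<gamma>
  proof -
    have "(\<lambda>a. ddeg (b + a) = \<delta> \<and> vdeg n (b + a) = \<gamma>)
        = (\<lambda>a. ddeg a = \<delta> - ddeg b \<and> vdeg n a = \<gamma> - vdeg n b)"
      by (auto simp: mon_deg_plus fun_eq_iff algebra_simps)
    moreover have "ev (restrict_mons (\<lambda>a. ddeg a = \<delta> - ddeg b \<and> vdeg n a = \<gamma> - vdeg n b) h)
        \<in> F_ge (vs ! n) (\<gamma> - vdeg n b + 1)"
      using h unfolding ideal_J_iff[OF n] F_gt_eq_F_ge by blast
    moreover have "scale c (mval b) \<in> F_ge (vs ! n) (vdeg n b)"
      using mval_vdeg[OF b n] by (auto simp: F_ge_iff val_scale)
    ultimately show ?thesis
      using F_ge_mult by (fastforce simp: restrict_mons_single_times eval_at_single_times F_gt_eq_F_ge)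
  qed
  moreover have "Poly_Mapping.single b c * h \<in> carrier XR"
    using h b ideal_J_carrier[of "vs ! n"]
    by (intro poly_ring_closed(3)) (auto simp: poly_ring_carrier_iff[of "Poly_Mapping.single b c"])
  ultimately show ?thesis by (simp add: ideal_J_iff[OF n])
qed

lemma component_hom_J:
  assumes i: "i < length vs" and p: "p \<in> hom_J scale Agr vs fs i"
  shows "p \<in> carrier XTR" "component d p \<in> ideal_J scale Agr (vs ! i) fs"
proof -
  have "hom_ideal vs fs (ideal_J scale Agr (vs ! i) fs)
      \<subseteq> {p \<in> carrier XTR. \<forall>d. component d p \<in> ideal_J scale Agr (vs ! i) fs}"
    by (intro hom_ideal_subset graded_ideal[where Q = "\<lambda>d u. u \<in> ideal_J scale Agr (vs ! i) fs"]
        ideal_J_carrier)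
      (use i in \<open>simp_all add: ideal_J_zero ideal_J_add ideal_J_single_times is_xmon_x_part\<close>)
  with p show "p \<in> carrier XTR" "component d p \<in> ideal_J scale Agr (vs ! i) fs"
    unfolding hom_J_def by blast+
qed

text \<open>Multiplication by a monomial preserves the gain at \<open>i\<close>. Replacing
  \<open>b\<close> by \<open>x_part b\<close> is harmless, since dropping a \<open>Tv n\<close> can
  only raise degrees.\<close>

lemma filt_component_ideal:
  assumes "i < length vs" "set fs \<subseteq> G"
  shows "ideal {p \<in> carrier XTR. \<forall>d. filt scale vs G (bump i d) (ev (component d p))} XTR"
proof (rule graded_ideal)
  fix d b c u
  assume b: "is_xtmon b" and u: "filt scale vs G (bump i (\<lambda>n. d n - vdeg n b)) (ev u)"
  have "filt scale vs G (bump i d) (mval (x_part b) * ev u)"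
  proof (rule filt.mult[OF filt_mval[OF assms(2) is_xmon_x_part[OF b]] u], intro allI impI)
    fix n
    show "bump i d n \<le> vdeg n (x_part b) + bump i (\<lambda>n. d n - vdeg n b) n"
      using vdeg_x_part[of n b] vdeg_x_part[of i b] by simp
  qed
  then show "filt scale vs G (bump i d) (ev (Poly_Mapping.single (x_part b) c * u))"
    unfolding eval_at_single_times by (simp add: filt_scale flip: scale_mult_left)
qed (auto simp: eval_at_add intro: filt.add)

lemma test_ideal_ideal:
  assumes "i < length vs" shows "ideal (test_ideal scale vs fs i) XTR"
proof -
  interpret cring XTR by (rule cring_poly_ring)
  have "Var (Tv i) \<in> carrier XTR"
    using assms by (auto simp: poly_ring_carrier_iff Var_def)
  then show ?thesis
    unfolding test_ideal_def by (intro add_ideals hom_ideal_ideal cgenideal_ideal ideal_I_carrier)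
qed

lemma test_ideal_iff:
  "p \<in> test_ideal scale vs fs i
    \<longleftrightarrow> (\<exists>x\<in>hom_ideal vs fs (ideal_I scale fs). \<exists>q\<in>carrier XTR. p = x + q * Var (Tv i))"
  unfolding test_ideal_def set_add_def' cgenideal_def by auto

text \<open>Only the two kinds of generators matter: components of homogenized relations evaluate to
  0, and \<open>Tv i\<close> has a gain of one built into its degree.\<close>

lemma filt_component_test_ideal:
  assumes i: "i < length vs" and G: "set fs \<subseteq> G" and p: "p \<in> test_ideal scale vs fs i"
  shows "filt scale vs G (bump i d) (ev (component d p))"
proof -
  let ?S = "{p \<in> carrier XTR. \<forall>d. filt scale vs G (bump i d) (ev (component d p))}"
  have S: "ideal ?S XTR" by (rule filt_component_ideal[OF i G])
  have "hom_ideal vs fs (ideal_I scale fs) \<subseteq> ?S"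
    by (rule hom_ideal_subset[OF ideal_I_carrier S]) (auto simp: ideal_I_def)
  moreover have "Var (Tv i) \<in> ?S"
  proof -
    \<comment> \<open>The multidegree of \<open>Tv i\<close> is -1 at \<open>i\<close> and 0
      elsewhere. Raised by one at \<open>i\<close> it is the zero vector, and \<open>1\<close>, the
      dehomogenization of \<open>Tv i\<close>, lies in that step.\<close>
    have T: "has_vdeg (\<lambda>n. if n = i then - 1 else 0) (Poly_Mapping.single (Tv i) 1)"
      by (auto simp: has_vdeg_def mon_deg_single val_weight_T)
    have "component d (Var (Tv i)) = (if \<forall>n<length vs. d n = (if n = i then - 1 else 0) then 1 else 0)" for d
      using component_homogeneous[of "Var (Tv i)" "\<lambda>n. if n = i then - 1 else 0" d] T
      by (simp add: Var_def deh_single x_part_single)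
    moreover have "ev 1 = 1"
      using eval_at_const[of fs 1] by simp
    ultimately show ?thesis
      using i by (auto simp: poly_ring_carrier_iff Var_def intro!: filt_one)
  qed
  ultimately have "p \<in> ?S"
    using p S unfolding test_ideal_iff poly_ring_ideal_iff by blast
  then show ?thesis by blast
qed

text \<open>The terms of degree exactly \<open>\<gamma>\<close> cancel to a larger value because
  \<open>h\<close> is in the kernel; the degrees of the other terms are already at least
  \<open>\<gamma> + 1\<close>.\<close>

lemma ev_ideal_J:
  assumes i: "i < length vs" and h: "h \<in> ideal_J scale Agr (vs ! i) fs"
    and hom: "\<And>a. a \<in> Poly_Mapping.keys h \<Longrightarrow> ddeg a = \<delta>"
    and ge: "\<And>a. a \<in> Poly_Mapping.keys h \<Longrightarrow> \<gamma> \<le> vdeg i a"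
  shows "ev h \<in> F_ge (vs ! i) (\<gamma> + 1)"
proof -
  interpret valued_algebra scale "vs ! i" by (rule val_nth[OF i])
  let ?P = "\<lambda>a. ddeg a = \<delta> \<and> vdeg i a = \<gamma>"
  have "ev h = ev (restrict_mons ?P h) + ev (restrict_mons (\<lambda>a. \<not> ?P a) h)"
    unfolding eval_at_add[symmetric] restrict_mons_split by (rule refl)
  moreover have "ev (restrict_mons ?P h) \<in> F_ge (vs ! i) (\<gamma> + 1)"
    using h unfolding ideal_J_iff[OF i] F_gt_eq_F_ge by blast
  moreover have "ev (restrict_mons (\<lambda>a. \<not> ?P a) h) \<in> F_ge (vs ! i) (\<gamma> + 1)"
    by (rule ev_F_ge[OF i restrict_mons_carrier])
      (use h hom ge ideal_J_carrier in \<open>force simp: keys_restrict_mons\<close>)+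
  ultimately show ?thesis by (simp add: F_ge_add)
qed

text \<open>Hypothesis \<open>J\<close> is what a passed test and an executed pass of the for-loop
  have in common, so the exchange of lowest terms is carried out once for both.\<close>

lemma improve:
  assumes i: "i < length vs" and G: "set fs \<subseteq> G"
    and J: "\<And>p d. p \<in> hom_J scale Agr vs fs i \<Longrightarrow> filt scale vs G (bump i d) (ev (component d p))"
    and f: "f \<in> Agr \<delta>" "f \<noteq> 0" "filt scale vs (set fs) d f" "d i < (vs ! i) f"
  shows "filt scale vs G (bump i d) f"
proof -
  interpret valued_algebra scale "vs ! i" by (rule val_nth[OF i])
  obtain h' where h': "h' \<in> carrier XR" "ev h' = f" "vdeg_ge d h'"
    using filt_imp_poly[OF f(3)] by blast
  \<comment> \<open>The kernel separates Delta-degrees, so the lowest terms form an element of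
    \<open>J_i\<close> only after the parts of other Delta-degrees are discarded.\<close>
  define h where "h = restrict_mons (\<lambda>a. ddeg a = \<delta>) h'"
  have h: "h \<in> carrier XR" "ev h = f" "vdeg_ge d h" "\<And>a. a \<in> Poly_Mapping.keys h \<Longrightarrow> ddeg a = \<delta>"
    using h' f(1) ev_ddeg_part[of h' \<delta>]
    by (auto simp: h_def restrict_mons_carrier vdeg_ge_def keys_restrict_mons)
  define low where "low = restrict_mons (\<lambda>a. vdeg i a = d i) h"
  define high where "high = restrict_mons (\<lambda>a. vdeg i a \<noteq> d i) h"
  have split: "f = ev low + ev high"
    using restrict_mons_split[of "\<lambda>a. vdeg i a = d i" h] h(2)
    by (simp add: low_def high_def flip: eval_at_add)
  have carrier: "low \<in> carrier XR" "high \<in> carrier XR"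
    using h(1) by (auto simp: low_def high_def restrict_mons_carrier)
  have low_ge: "vdeg_ge d low"
    using h(3) by (auto simp: low_def vdeg_ge_def keys_restrict_mons)
  have high_ge: "vdeg_ge (bump i d) high"
    using h(3) i by (fastforce simp: high_def vdeg_ge_def keys_restrict_mons)
  have "ev high \<in> F_ge (vs ! i) (d i + 1)"
    by (rule ev_F_ge[OF i carrier(2)]) (use high_ge i in \<open>force simp: vdeg_ge_def\<close>)
  moreover have "f \<in> F_ge (vs ! i) (d i + 1)" using f(4) by (simp add: F_ge_iff)
  ultimately have "f + - ev high \<in> F_ge (vs ! i) (d i + 1)"
    by (intro F_ge_add F_ge_uminus)
  then have ev_low: "ev low \<in> F_gt (vs ! i) (d i)"
    using split by (simp add: F_gt_eq_F_ge)
  have "ev (restrict_mons (\<lambda>a. ddeg a = \<epsilon> \<and> vdeg i a = \<gamma>) low) \<in> F_gt (vs ! i) \<gamma>" for \<epsilon> \<gamma>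
  proof (cases "\<epsilon> = \<delta> \<and> \<gamma> = d i")
    case True
    then have "restrict_mons (\<lambda>a. ddeg a = \<epsilon> \<and> vdeg i a = \<gamma>) low = low"
      using h(4) by (intro restrict_mons_id) (auto simp: low_def keys_restrict_mons)
    then show ?thesis using ev_low True by simp
  next
    case False
    then have "restrict_mons (\<lambda>a. ddeg a = \<epsilon> \<and> vdeg i a = \<gamma>) low = 0"
      using h(4) by (intro restrict_mons_empty) (auto simp: low_def keys_restrict_mons)
    then show ?thesis by (simp add: F_gt_iff)
  qed
  then have "low \<in> ideal_J scale Agr (vs ! i) fs"
    using carrier(1) by (simp add: ideal_J_iff[OF i])
  \<comment> \<open>Lifting to \<open>d\<close>, not to the minimal multidegree of
    \<open>low\<close>, makes \<open>low\<close> the component at \<open>d\<close> itself, which is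
    where \<open>J\<close> yields the bound \<open>bump i d\<close>.\<close>
  then have "lift_to d low \<in> hom_J scale Agr vs fs i"
    unfolding hom_J_def by (intro lift_to_in_hom_ideal ideal_J_carrier low_ge)
  from J[OF this, of d] have "filt scale vs G (bump i d) (ev low)"
    by (simp add: component_lift_to[OF carrier(1) low_ge])
  moreover have "filt scale vs G (bump i d) (ev high)"
    by (rule filt_ev[OF G carrier(2) high_ge])
  ultimately show ?thesis unfolding split by (rule filt.add)
qed

lemma improve_if_tests_pass:
  assumes "\<not> loop_condition scale Agr vs fs" "i < length vs"
    and "f \<in> Agr \<delta>" "f \<noteq> 0" "filt scale vs (set fs) d f" "d i < (vs ! i) f"
  shows "filt scale vs (set fs) (bump i d) f"
proof (rule improve[OF assms(2) subset_refl _ assms(3-6)])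
  fix p d assume "p \<in> hom_J scale Agr vs fs i"
  then have "p \<in> test_ideal scale vs fs i"
    using assms(1,2) unfolding loop_condition_def by blast
  then show "filt scale vs (set fs) (bump i d) (ev (component d p))"
    by (rule filt_component_test_ideal[OF assms(2) subset_refl])
qed

text \<open>Induction on the total distance of \<open>d\<close> from the values of \<open>f\<close>;
  coordinates that have reached their value count 0.\<close>

lemma filt_max_if_tests_pass:
  assumes "\<not> loop_condition scale Agr vs fs"
    and f: "f \<in> Agr \<delta>" "f \<noteq> 0" "filt scale vs (set fs) d f"
  shows "filt scale vs (set fs) (\<lambda>n. (vs ! n) f) f"
  using f(3)
proof (induction "\<Sum>n<length vs. nat ((vs ! n) f - d n)" arbitrary: d rule: less_induct)
  case less
  show ?case
  proof (cases "\<exists>i<length vs. d i < (vs ! i) f")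
    case True
    then obtain i where i: "i < length vs" "d i < (vs ! i) f" by blast
    have "(\<Sum>n<length vs. nat ((vs ! n) f - bump i d n)) < (\<Sum>n<length vs. nat ((vs ! n) f - d n))"
      by (rule sum_strict_mono_ex1) (use i in auto)
    moreover have "filt scale vs (set fs) (bump i d) f"
      by (rule improve_if_tests_pass[OF assms(1) i(1) f(1,2) less.prems i(2)])
    ultimately show ?thesis by (rule less.hyps)
  next
    case False
    then show ?thesis by (intro filt_antimono[OF less.prems]) (meson not_less)
  qed
qed

text \<open>
  Each part \<open>?h \<delta>\<close> of \<open>h\<close> is exchanged for a polynomial \<open>w \<delta>\<close> with the same value and one more power
  of \<open>Tv i\<close>; the difference lies in \<^term>\<open>ideal_I scale fs\<close>.
\<close>

lemma tests_pass_if_filt_max: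
  assumes max: "\<And>f \<delta>. f \<in> Agr \<delta> \<Longrightarrow> f \<noteq> 0 \<Longrightarrow> filt scale vs (set fs) (\<lambda>n. (vs ! n) f) f"
  shows "\<not> loop_condition scale Agr vs fs"
proof -
  interpret cring XTR by (rule cring_poly_ring)
  have "hom_poly vs fs h \<in> test_ideal scale vs fs i"
    if i: "i < length vs" and h: "h \<in> ideal_J scale Agr (vs ! i) fs" for i h
  proof -
    interpret valued_algebra scale "vs ! i" by (rule val_nth[OF i])
    define \<mu> where "\<mu> = (\<lambda>n. Min (vdeg n ` Poly_Mapping.keys h))"
    have hX: "h \<in> carrier XR" using h ideal_J_carrier by blast
    have h_ge: "vdeg_ge \<mu> h" unfolding \<mu>_def by (rule vdeg_ge_Min)
    let ?h = "\<lambda>\<delta>. restrict_mons (\<lambda>a. ddeg a = \<delta>) h"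
    have part_X: "?h \<delta> \<in> carrier XR" for \<delta> using hX by (rule restrict_mons_carrier)
    \<comment> \<open>\<open>h\<close> may mix Delta-degrees, while \<open>max\<close> speaks of
      nonzero homogeneous elements only; hence the treatment by Delta-degree and the separate case
      of a part with value zero.\<close>
    have "\<exists>w\<in>carrier XR. ev w = ev (?h \<delta>) \<and> vdeg_ge (bump i \<mu>) w" for \<delta>
    proof (cases "ev (?h \<delta>) = 0")
      case True
      then show ?thesis by (intro bexI[of _ 0]) (auto simp: vdeg_ge_def poly_ring_closed)
    next
      case False
      have "?h \<delta> \<in> ideal_J scale Agr (vs ! i) fs"
      proof -
        have "ev (restrict_mons (\<lambda>a. ddeg a = \<epsilon> \<and> vdeg i a = \<gamma>) (?h \<delta>)) \<in> F_gt (vs ! i) \<gamma>" for \<epsilon> \<gamma>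
        proof (cases "\<epsilon> = \<delta>")
          case True
          then have "restrict_mons (\<lambda>a. ddeg a = \<epsilon> \<and> vdeg i a = \<gamma>) (?h \<delta>)
              = restrict_mons (\<lambda>a. ddeg a = \<epsilon> \<and> vdeg i a = \<gamma>) h"
            unfolding restrict_mons_restrict by (intro restrict_mons_cong) auto
          then show ?thesis using h by (simp add: ideal_J_iff[OF i])
        next
          case False
          then have "restrict_mons (\<lambda>a. ddeg a = \<epsilon> \<and> vdeg i a = \<gamma>) (?h \<delta>) = 0"
            by (intro restrict_mons_empty) (auto simp: keys_restrict_mons)
          then show ?thesis by (simp add: F_gt_iff)
        qed
        then show ?thesis using part_X by (simp add: ideal_J_iff[OF i])
      qed
      then have "ev (?h \<delta>) \<in> F_ge (vs ! i) (\<mu> i + 1)"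
        by (rule ev_ideal_J[OF i]) (use h_ge i in \<open>auto simp: keys_restrict_mons vdeg_ge_def\<close>)
      moreover have "ev (?h \<delta>) \<in> F_ge (vs ! n) (\<mu> n)" if "n < length vs" for n
        by (rule ev_F_ge[OF that part_X]) (use h_ge that in \<open>auto simp: keys_restrict_mons vdeg_ge_def\<close>)
      ultimately have "\<forall>n<length vs. bump i \<mu> n \<le> (vs ! n) (ev (?h \<delta>))"
        using False by (auto simp: F_ge_def)
      moreover have "ev (?h \<delta>) \<in> Agr \<delta>"
        by (rule ev_Agr[OF part_X]) (simp add: keys_restrict_mons)
      ultimately have "filt scale vs (set fs) (bump i \<mu>) (ev (?h \<delta>))"
        using False by (intro filt_antimono[OF max])
      then show ?thesis by (rule filt_imp_poly)
    qed
    then obtain w where w: "\<And>\<delta>. w \<delta> \<in> carrier XR" "\<And>\<delta>. ev (w \<delta>) = ev (?h \<delta>)"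
        "\<And>\<delta>. vdeg_ge (bump i \<mu>) (w \<delta>)"
      by metis
    define W where "W = (\<Sum>\<delta>\<in>(\<lambda>a. ddeg a) ` Poly_Mapping.keys h. w \<delta>)"
    have WX: "W \<in> carrier XR"
      unfolding W_def by (rule ring_surjection.T_sum[OF poly_ring_surjection, folded poly_ring_carrier_iff, simplified])
        (use w(1) in \<open>auto simp: poly_ring_carrier_iff\<close>)
    have "vdeg_ge (bump i \<mu>) (\<Sum>\<delta>\<in>D. w \<delta>)" for D
    proof (induction D rule: infinite_finite_induct)
      case (insert \<delta> D)
      show ?case unfolding sum.insert[OF insert(1,2)] by (rule vdeg_ge_add[OF w(3) insert.IH])
    qed (simp_all add: vdeg_ge_def)
    then have W_ge: "vdeg_ge (bump i \<mu>) W" by (simp add: W_def)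
    have "ev W = ev h"
      unfolding W_def eval_at_sum w(2) by (simp add: sum_restrict_mons_fibers flip: eval_at_sum)
    then have I: "h - W \<in> ideal_I scale fs"
      using hX WX by (simp add: ideal_I_def eval_at_diff poly_ring_closed)
    \<comment> \<open>With this bound \<open>h\<close>, \<open>W\<close> and their difference can
      all be lifted to the same multidegree \<open>\<mu>\<close>, although the minimal degrees of
      the difference may be larger.\<close>
    have "vdeg_ge \<mu> W"
      using W_ge by (fastforce simp: vdeg_ge_def split: if_splits)
    then have "vdeg_ge \<mu> (h - W)"
      using h_ge keys_diff[of h W] unfolding vdeg_ge_def by blast
    then have "lift_to \<mu> (h - W) \<in> hom_ideal vs fs (ideal_I scale fs)"
      by (rule lift_to_in_hom_ideal[OF ideal_I_carrier I])
    moreover have "lift_to \<mu> h = lift_to \<mu> (h - W) + lift_to (bump i \<mu>) W * Var (Tv i)"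
      using lift_to_add[of \<mu> "h - W" W] lift_to_bump[OF i W_ge] by (simp add: mult.commute)
    ultimately show ?thesis
      using lift_to_carrier[OF WX] unfolding hom_poly_eq_lift_to \<mu>_def[symmetric] test_ideal_iff by blast
  qed
  then have "hom_J scale Agr vs fs i \<subseteq> test_ideal scale vs fs i" if "i < length vs" for i
    unfolding hom_J_def hom_ideal_def
    by (intro genideal_minimal test_ideal_ideal) (use that in auto)
  then show ?thesis by (auto simp: loop_condition_def)
qed

end

section \<open>The algorithm\<close>

context generators
begin

lemma for_step_mono: "for_step scale Agr vs i fs fs' \<Longrightarrow> set fs \<subseteq> set fs'"
  by (auto simp: for_step_def)

text \<open>A multihomogeneous \<open>h\<close> is recovered from its dehomogenization by lifting.
  If that evaluated to 0, then \<open>h\<close> would lie in the homogenization of \<open>I\<close>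
  and pass the test. Adjoined elements are thus nonzero and have a value under each
  valuation.\<close>

lemma new_generator:
  assumes i: "i < length vs" and h: "h \<in> carrier XTR" "h \<notin> test_ideal scale vs fs i"
    and hom: "homogeneous_poly (Delta_weight Agr fs) h" "\<And>n. n < length vs \<Longrightarrow> homogeneous_poly (val_weight vs fs n) h"
  shows "ev (deh h) \<noteq> 0" "homogeneous_elem Agr (ev (deh h))"
proof -
  obtain \<delta> where \<delta>: "\<And>a. a \<in> Poly_Mapping.keys h \<Longrightarrow> ddeg a = \<delta>"
    using hom(1) by (auto simp: homogeneous_poly_def)
  have "ev (deh h) \<in> Agr \<delta>"
    using keys_linear_sum_single[of x_part h] \<delta> ddeg_x_part
    by (intro ev_Agr deh_carrier h(1)) (auto simp: deh_eq)
  then show "homogeneous_elem Agr (ev (deh h))" by (auto simp: homogeneous_elem_def)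
  obtain e where e: "\<And>n a. n < length vs \<Longrightarrow> a \<in> Poly_Mapping.keys h \<Longrightarrow> vdeg n a = e n"
    using hom(2) unfolding homogeneous_poly_def by metis
  then have vdeg: "has_vdeg e a" if "a \<in> Poly_Mapping.keys h" for a
    using that by (simp add: has_vdeg_def)
  show "ev (deh h) \<noteq> 0"
  proof
    assume "ev (deh h) = 0"
    then have "deh h \<in> ideal_I scale fs"
      using deh_carrier[OF h(1)] by (simp add: ideal_I_def)
    moreover have "vdeg_ge e (deh h)" by (rule vdeg_ge_deh) (rule vdeg)
    ultimately have "lift_to e (deh h) \<in> hom_ideal vs fs (ideal_I scale fs)"
      by (rule lift_to_in_hom_ideal[OF ideal_I_carrier])
    moreover have "lift_to e (deh h) = h" by (rule lift_to_deh[OF h(1)]) (rule vdeg)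
    moreover have "h = h + 0 * Var (Tv i)" by simp
    ultimately show False
      using h(2) poly_ring_closed(1) unfolding test_ideal_iff by metis
  qed
qed

text \<open>In its only nonzero multidegree \<open>d\<close>, an \<open>h\<close> failing the test
  evaluates to an adjoined generator. Membership in \<open>J_i\<close> gives it an
  \<open>i\<close>-th value of at least \<open>d i + 1\<close>, and the degrees of its terms bound
  the other values.\<close>

lemma filt_component_generator:
  assumes i: "i < length vs" and G: "set fs \<subseteq> G" and h: "h \<in> hom_J scale Agr vs fs i"
    and hom: "homogeneous_poly (Delta_weight Agr fs) h" "\<And>n. n < length vs \<Longrightarrow> homogeneous_poly (val_weight vs fs n) h"
    and new: "h \<notin> test_ideal scale vs fs i \<Longrightarrow> ev (deh h) \<in> G"
  shows "filt scale vs G (bump i d) (ev (component d h))"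
proof (cases "h \<in> test_ideal scale vs fs i")
  case True
  then show ?thesis by (rule filt_component_test_ideal[OF i G])
next
  case False
  obtain \<delta> where \<delta>: "\<And>a. a \<in> Poly_Mapping.keys h \<Longrightarrow> ddeg a = \<delta>"
    using hom(1) by (auto simp: homogeneous_poly_def)
  obtain e where e: "\<And>n a. n < length vs \<Longrightarrow> a \<in> Poly_Mapping.keys h \<Longrightarrow> vdeg n a = e n"
    using hom(2) unfolding homogeneous_poly_def by metis
  have comp: "component d h = (if \<forall>n<length vs. d n = e n then deh h else 0)"
    by (rule component_homogeneous) (simp add: has_vdeg_def e)
  show ?thesis
  proof (cases "\<forall>n<length vs. d n = e n")
    case True
    have hX: "h \<in> carrier XTR" and J: "deh h \<in> ideal_J scale Agr (vs ! i) fs"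
      using component_hom_J(1)[OF i h] component_hom_J(2)[OF i h, of d] comp True by auto
    have ge: "vdeg_ge d (deh h)"
      using vdeg_ge_component[of d h] comp True by simp
    have "ev (deh h) \<noteq> 0" by (rule new_generator(1)[OF i hX False hom])
    moreover have "ev (deh h) \<in> F_ge (vs ! i) (d i + 1)"
    proof (rule ev_ideal_J[OF i J])
      fix a assume a: "a \<in> Poly_Mapping.keys (deh h)"
      then show "d i \<le> vdeg i a" using ge i by (simp add: vdeg_ge_def)
      show "ddeg a = \<delta>"
        using a keys_linear_sum_single[of x_part h] \<delta> ddeg_x_part by (auto simp: deh_eq)
    qed
    moreover have "ev (deh h) \<in> F_ge (vs ! n) (d n)" if "n < length vs" for n
      by (rule ev_F_ge[OF that deh_carrier[OF hX]]) (use ge that in \<open>simp add: vdeg_ge_def\<close>)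
    ultimately have "\<forall>n<length vs. bump i d n \<le> (vs ! n) (ev (deh h))"
      by (auto simp: F_ge_def)
    then have "filt scale vs G (bump i d) (ev (deh h))"
      by (rule filt.gen[OF new[OF False]])
    with comp True show ?thesis by simp
  qed (simp only: comp if_False eval_at_zero filt_zero)
qed

lemma for_step_generators:
  assumes step: "for_step scale Agr vs i fs fs'" and i: "i < length vs"
  shows "generators scale A Agr vs fs'"
proof unfold_locales
  fix f assume f: "f \<in> set fs'"
  show "f \<noteq> 0 \<and> f \<in> A \<and> homogeneous_elem Agr f"
  proof (cases "f \<in> set fs")
    case False
    obtain hs where hs: "set hs \<subseteq> carrier XTR"
      "\<forall>h\<in>set hs. homogeneous_poly (Delta_weight Agr fs) h \<and>
         (\<forall>n<length vs. homogeneous_poly (val_weight vs fs n) h)"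
      "set fs' = set fs \<union> {ev (deh h) | h. h \<in> set hs \<and> h \<notin> test_ideal scale vs fs i}"
      using step unfolding for_step_def by blast
    then obtain h where "h \<in> set hs" "h \<notin> test_ideal scale vs fs i" "f = ev (deh h)"
      using f False by blast
    with new_generator[OF i, of h] hs have "f \<noteq> 0" "homogeneous_elem Agr f" by auto
    then show ?thesis using Agr_subset by (auto simp: homogeneous_elem_def)
  qed (simp add: fs)
qed

text \<open>The elements with the desired components form an ideal, so it is enough to inspect the
  chosen generators \<open>hs\<close>. The gain is therefore the same for every choice of
  them.\<close>

lemma for_step_improves:
  assumes step: "for_step scale Agr vs i fs fs'" and i: "i < length vs"
    and f: "f \<in> Agr \<delta>" "f \<noteq> 0" "filt scale vs (set fs) d f" "d i < (vs ! i) f"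
  shows "filt scale vs (set fs') (bump i d) f"
proof (rule improve[OF i for_step_mono[OF step] _ f])
  fix p d assume p: "p \<in> hom_J scale Agr vs fs i"
  interpret R: cring XTR by (rule cring_poly_ring)
  let ?S = "{p \<in> carrier XTR. \<forall>d. filt scale vs (set fs') (bump i d) (ev (component d p))}"
  have G: "set fs \<subseteq> set fs'" by (rule for_step_mono[OF step])
  obtain hs where hs: "set hs \<subseteq> carrier XTR" "Idl\<^bsub>XTR\<^esub> (set hs) = hom_J scale Agr vs fs i"
    "\<forall>h\<in>set hs. homogeneous_poly (Delta_weight Agr fs) h \<and>
         (\<forall>n<length vs. homogeneous_poly (val_weight vs fs n) h)"
    "set fs' = set fs \<union> {ev (deh h) | h. h \<in> set hs \<and> h \<notin> test_ideal scale vs fs i}"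
    using step unfolding for_step_def by blast
  have "set hs \<subseteq> ?S"
  proof
    fix h assume h: "h \<in> set hs"
    then have "h \<in> hom_J scale Agr vs fs i"
      using R.genideal_self[OF hs(1)] hs(2) by blast
    then have "filt scale vs (set fs') (bump i d) (ev (component d h))" for d
      using h hs(3,4) by (intro filt_component_generator[OF i G]) auto
    with h hs(1) show "h \<in> ?S" by blast
  qed
  then have "hom_J scale Agr vs fs i \<subseteq> ?S"
    unfolding hs(2)[symmetric] by (rule R.genideal_minimal[OF filt_component_ideal[OF i G]])
  with p show "filt scale vs (set fs') (bump i d) (ev (component d p))" by blast
qed

lemma muvak_basis_if_filt_max:
  assumes gen: "generated_alg scale (set fs) = A"
    and max: "\<And>f \<delta>. f \<in> Agr \<delta> \<Longrightarrow> f \<noteq> 0 \<Longrightarrow> filt scale vs (set fs) (\<lambda>n. (vs ! n) f) f"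
  shows "muvak_basis scale A Agr vs (set fs)"
proof -
  have "faithfully_representable scale vs f fs" if f: "f \<in> Agr \<delta>" for f \<delta>
  proof (cases "f = 0")
    \<comment> \<open>The zero polynomial represents 0 and has no terms, so nothing has to be
      compared with an infinite value.\<close>
    case True
    then show ?thesis
      unfolding faithfully_representable_def
      by (intro bexI[of _ 0]) (auto simp: Supp_def poly_ring_closed)
  next
    case False
    obtain h where h: "h \<in> carrier XR" "ev h = f" "vdeg_ge (\<lambda>n. (vs ! n) f) h"
      using filt_imp_poly[OF max[OF f False]] by blast
    have "ext_val v f \<le> ext_val v (ev t)" if t: "t \<in> Supp h" and v: "v \<in> set vs" for t v
    proof -
      obtain a where a: "a \<in> Poly_Mapping.keys h" "t = Poly_Mapping.single a (Poly_Mapping.lookup h a)"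
        using t by (auto simp: Supp_def)
      obtain n where n: "n < length vs" "v = vs ! n" using v by (metis in_set_conv_nth)
      interpret valued_algebra scale "vs ! n" by (rule val_nth[OF n(1)])
      have "is_xmon a" "Poly_Mapping.lookup h a \<noteq> 0"
        using a h(1) by (auto simp: poly_ring_carrier_iff in_keys_iff)
      then have "ev t \<noteq> 0" "v (ev t) = vdeg n a"
        using mval_vdeg[of a n] n by (auto simp: a(2) eval_at_single val_scale)
      moreover have "v f \<le> vdeg n a"
        using h(3) a(1) n by (simp add: vdeg_ge_def)
      ultimately show ?thesis using False by (simp add: ext_val_def)
    qed
    with h show ?thesis unfolding faithfully_representable_def by blast
  qed
  then show ?thesis
    using fs gen unfolding muvak_basis_def homogeneous_elem_def by blast
qed

text \<open>Sums use the minimum of two multidegrees and products their sum, so the elements having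
  some \<open>d\<close> form a subalgebra. This \<open>d\<close> is where the improvement
  starts.\<close>

lemma filt_exists:
  assumes "generated_alg scale (set fs) = A" "f \<in> A"
  shows "\<exists>d. filt scale vs (set fs) d f"
proof -
  have "f \<in> subalg scale hull set fs" using assms by simp
  then show ?thesis
  proof (rule hull_induct)
    show "\<exists>d. filt scale vs (set fs) d g" if "g \<in> set fs" for g
      by (intro exI[of _ "\<lambda>n. (vs ! n) g"] filt.gen[OF that]) simp
    have min: "\<exists>d. filt scale vs (set fs) d x \<and> filt scale vs (set fs) d y"
      if "filt scale vs (set fs) d x" "filt scale vs (set fs) e y" for x y d e
      using filt_antimono[OF that(1), of "\<lambda>n. min (d n) (e n)"] filt_antimono[OF that(2), of "\<lambda>n. min (d n) (e n)"]
      by auto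
    have "subspace {f. \<exists>d. filt scale vs (set fs) d f}"
      unfolding subspace_def using min by (auto intro: filt_scale) (meson filt.add min)
    moreover have "filt scale vs (set fs) (\<lambda>_. 0) 1" by (rule filt_one) simp
    moreover have "\<exists>d. filt scale vs (set fs) d (x * y)"
      if "filt scale vs (set fs) d x" "filt scale vs (set fs) e y" for x y d e
      using filt.mult[OF that, of "\<lambda>n. d n + e n"] by auto
    ultimately show "subalg scale {f. \<exists>d. filt scale vs (set fs) d f}"
      unfolding subalg_def by blast
  qed
qed

end

section \<open>Rounds and runs of the algorithm\<close>

context muvak_setting
begin

lemma filt_if_muvak_basis:
  assumes G: "muvak_basis scale A Agr vs G" and f: "f \<in> Agr \<delta>" "f \<noteq> 0"
  shows "filt scale vs (G - {0}) (\<lambda>n. (vs ! n) f) f"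
proof -
  obtain gs h where gs: "set gs \<subseteq> G" and h: "h \<in> carrier (X_ring (length gs))" "eval_at scale gs h = f"
    and terms: "\<forall>t\<in>Supp h. \<forall>v\<in>set vs. ext_val v (eval_at scale gs t) \<ge> ext_val v f"
    using G f Agr_subset unfolding muvak_basis_def faithfully_representable_def homogeneous_elem_def
    by blast
  have mon: "filt scale vs (G - {0}) (\<lambda>n. (vs ! n) (mon_eval (assign gs) a)) (mon_eval (assign gs) a)"
    if "Poly_Mapping.keys a \<subseteq> Xv ` {..<length gs}" "mon_eval (assign gs) a \<noteq> 0" for a
    using that
  proof (induction a rule: monomial_induct)
    case zero
    then show ?case by (simp add: filt_one valued_algebra.val_1[OF val_nth])
  next
    case (var x)
    then obtain j where "x = Xv j" "j < length gs" by auto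
    with var gs show ?case by (auto intro!: filt.gen)
  next
    case (add a b)
    then show ?case
      unfolding mon_eval_plus
      by (intro filt.mult[of _ _ _ "\<lambda>n. (vs ! n) (mon_eval (assign gs) a)" _
            "\<lambda>n. (vs ! n) (mon_eval (assign gs) b)"])
        (auto simp: valued_algebra.val_mult[OF val_nth] keys_plus_nat)
  qed
  have "filt scale vs (G - {0}) (\<lambda>n. (vs ! n) f) (scale (Poly_Mapping.lookup h a) (mon_eval (assign gs) a))"
    if a: "a \<in> Poly_Mapping.keys h" for a
  proof (cases "mon_eval (assign gs) a = 0")
    case False
    have c: "Poly_Mapping.lookup h a \<noteq> 0" using a by (simp add: in_keys_iff)
    have "(vs ! n) f \<le> (vs ! n) (mon_eval (assign gs) a)" if n: "n < length vs" for n
    proof -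
      interpret valued_algebra scale "vs ! n" by (rule val_nth[OF n])
      have "ext_val (vs ! n) f \<le> ext_val (vs ! n) (scale (Poly_Mapping.lookup h a) (mon_eval (assign gs) a))"
        using terms a n by (auto simp: Supp_def simp flip: eval_at_single)
      then show ?thesis using f(2) c False by (simp add: ext_val_def val_scale)
    qed
    then show ?thesis
      using a h(1) by (intro filt_scale filt_antimono[OF mon[OF _ False]]) (auto simp: poly_ring_carrier_iff)
  qed simp
  then have "filt scale vs (G - {0}) (\<lambda>n. (vs ! n) f) (eval_at scale gs h)"
    unfolding eval_at_eq linear_sum_def by (rule filt_sum)
  then show ?thesis by (simp add: h(2))
qed

text \<open>The \<open>i\<close>-th pass raises coordinate \<open>i\<close> only. The minimum is
  there because a coordinate that has reached the value of \<open>f\<close> cannot be raised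
  further.\<close>

lemma loop_body_improves:
  assumes "generators scale A Agr vs fs" "loop_body scale Agr vs fs fs'"
  shows "generators scale A Agr vs fs'" "set fs \<subseteq> set fs'"
    and "f \<in> Agr \<delta> \<Longrightarrow> f \<noteq> 0 \<Longrightarrow> \<forall>n<length vs. d n \<le> (vs ! n) f \<Longrightarrow> filt scale vs (set fs) d f
      \<Longrightarrow> filt scale vs (set fs') (\<lambda>n. min ((vs ! n) f) (d n + 1)) f"
proof -
  obtain gs where gs: "gs 0 = fs" "gs (length vs) = fs'"
    "\<And>i. i < length vs \<Longrightarrow> for_step scale Agr vs i (gs i) (gs (Suc i))"
    using assms(2) unfolding loop_body_def by blast
  have "generators scale A Agr vs (gs k) \<and> set fs \<subseteq> set (gs k)" if "k \<le> length vs" for k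
    using that
  proof (induction k)
    case (Suc k)
    then interpret generators scale A Agr vs "gs k" by simp
    show ?case
      using Suc gs(3)[of k] for_step_generators[of k "gs (Suc k)"] for_step_mono[of k "gs (Suc k)"] by auto
  qed (simp add: assms gs)
  note gen = this
  from gen[of "length vs"] gs(2) show "generators scale A Agr vs fs'" "set fs \<subseteq> set fs'" by auto
  assume f: "f \<in> Agr \<delta>" "f \<noteq> 0" "\<forall>n<length vs. d n \<le> (vs ! n) f" "filt scale vs (set fs) d f"
  \<comment> \<open>Invariant of the for-loop: before pass \<open>k\<close> exactly the coordinates
    below \<open>k\<close> have been treated.\<close>
  have "filt scale vs (set (gs k)) (\<lambda>n. if n < k then min ((vs ! n) f) (d n + 1) else d n) f"
    if "k \<le> length vs" for k
    using that
  proof (induction k)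
    case (Suc k)
    then interpret generators scale A Agr vs "gs k" using gen by simp
    let ?d = "\<lambda>n. if n < k then min ((vs ! n) f) (d n + 1) else d n"
    have step: "for_step scale Agr vs k (gs k) (gs (Suc k))" using gs(3) Suc.prems by simp
    show ?case
    proof (cases "d k < (vs ! k) f")
      case True
      have "filt scale vs (set (gs (Suc k))) (?d(k := ?d k + 1)) f"
        by (rule for_step_improves[OF step _ f(1,2)]) (use Suc True in auto)
      then show ?thesis
        by (rule filt_antimono) (use True in \<open>auto simp: less_Suc_eq\<close>)
    next
      case False
      then show ?thesis
        using f(3) Suc by (intro filt_antimono[OF filt_mono[OF _ for_step_mono[OF step]]])
          (auto simp: less_Suc_eq)
    qed
  qed (simp add: gs f)
  from this[of "length vs"] show "filt scale vs (set fs') (\<lambda>n. min ((vs ! n) f) (d n + 1)) f"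
    unfolding gs(2) by (rule filt_antimono[OF _ ]) auto
qed

lemma muvak_run_generators:
  assumes run: "muvak_run scale Agr vs fs s" and fs: "generators scale A Agr vs fs"
  shows "generators scale A Agr vs (s n) \<and> set fs \<subseteq> set (s n)"
proof (induction n)
  case 0
  have "set (s 0) = set fs" using run by (simp add: muvak_run_def)
  moreover from this have "generators scale A Agr vs (s 0)"
    using generators.fs[OF fs] by unfold_locales auto
  ultimately show ?case by simp
next
  case (Suc n)
  have "if loop_condition scale Agr vs (s n) then loop_body scale Agr vs (s n) (s (Suc n)) else s (Suc n) = s n"
    using run by (simp add: muvak_run_def)
  with Suc show ?case
    using loop_body_improves(1,2)[of "s n" "s (Suc n)"] by (auto split: if_splits)
qed

lemma terminates_if_finite_muvak_basis:
  assumes run: "muvak_run scale Agr vs fs s" and fs: "generators scale A Agr vs fs"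
    and gen: "generated_alg scale (set fs) = A"
    and G: "finite G" "muvak_basis scale A Agr vs G"
  shows "terminates scale Agr vs s"
proof (rule ccontr)
  assume "\<not> terminates scale Agr vs s"
  then have loop: "loop_condition scale Agr vs (s n)" for n by (simp add: terminates_def)
  then have body: "loop_body scale Agr vs (s n) (s (Suc n))" for n
    using run by (simp add: muvak_run_def)
  note gens = muvak_run_generators[OF run fs, THEN conjunct1]
  have "\<forall>\<^sub>F N in sequentially. filt scale vs (set (s N)) (\<lambda>n. (vs ! n) f) f"
    if f: "f \<in> Agr \<delta>" "f \<noteq> 0" for f \<delta>
  proof -
    interpret generators scale A Agr vs fs by (rule fs)
    obtain e where "filt scale vs (set fs) e f"
      using filt_exists[OF gen] f(1) Agr_subset by blast
    \<comment> \<open>Cutting \<open>e\<close> down to the values of \<open>f\<close> only enlarges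
      the step, and puts the starting bound below the values.\<close>
    moreover define d where "d = (\<lambda>n. min (e n) ((vs ! n) f))"
    ultimately have d: "filt scale vs (set fs) d f" "\<forall>n. d n \<le> (vs ! n) f"
      by (auto simp: d_def intro: filt_antimono)
    have *: "filt scale vs (set (s N)) (\<lambda>n. min ((vs ! n) f) (d n + int N)) f" for N
    proof (induction N)
      case 0
      have "set (s 0) = set fs" using run by (simp add: muvak_run_def)
      with d(1) show ?case by (auto intro: filt_antimono)
    next
      case (Suc N)
      have "filt scale vs (set (s (Suc N)))
          (\<lambda>n. min ((vs ! n) f) (min ((vs ! n) f) (d n + int N) + 1)) f"
        by (rule loop_body_improves(3)[OF gens body f _ Suc.IH]) simp
      then show ?case by (rule filt_antimono) auto
    qed
    show ?thesis
    proof (rule eventually_sequentiallyI)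
      \<comment> \<open>The total distance bounds the distance in each coordinate, and each round
        reduces every positive one by one.\<close>
      fix N assume N: "(\<Sum>n<length vs. nat ((vs ! n) f - d n)) \<le> N"
      have "(vs ! n) f \<le> d n + int N" if "n < length vs" for n
      proof -
        have "nat ((vs ! n) f - d n) \<le> (\<Sum>n<length vs. nat ((vs ! n) f - d n))"
          using that by (intro member_le_sum) auto
        with N show ?thesis by linarith
      qed
      then show "filt scale vs (set (s N)) (\<lambda>n. (vs ! n) f) f"
        by (intro filt_antimono[OF *]) auto
    qed
  qed
  then have "\<forall>\<^sub>F N in sequentially. filt scale vs (set (s N)) (\<lambda>n. (vs ! n) g) g" if "g \<in> G - {0}" for g
    using G(2) that unfolding muvak_basis_def homogeneous_elem_def by blast
  \<comment> \<open>Finiteness of \<open>G\<close> enters here: each element is representable from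
    some round on, hence all of them are in a common round.\<close>
  then have "\<forall>\<^sub>F N in sequentially. \<forall>g\<in>G - {0}. filt scale vs (set (s N)) (\<lambda>n. (vs ! n) g) g"
    using G(1) by (intro eventually_ball_finite) auto
  from eventually_happens'[OF sequentially_bot this]
  obtain N where N: "\<And>g. g \<in> G - {0} \<Longrightarrow> filt scale vs (set (s N)) (\<lambda>n. (vs ! n) g) g"
    by blast
  interpret generators scale A Agr vs "s N" by (rule gens)
  \<comment> \<open>Every nonzero homogeneous element is representable over \<open>G - {0}\<close>,
    and the elements of \<open>G - {0}\<close> over \<open>s N\<close>, so transitivity
    applies.\<close>
  have "\<not> loop_condition scale Agr vs (s N)"
    by (rule tests_pass_if_filt_max) (rule filt_generators[OF filt_if_muvak_basis[OF G(2)] N])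
  with loop show False by blast
qed

lemma muvak_basis_if_terminates:
  assumes run: "muvak_run scale Agr vs fs s" and fs: "generators scale A Agr vs fs"
    and gen: "generated_alg scale (set fs) = A" and A: "subalg scale A"
    and stop: "\<not> loop_condition scale Agr vs (s n)"
  shows "muvak_basis scale A Agr vs (set (s n))"
proof -
  interpret generators scale A Agr vs "s n"
    using muvak_run_generators[OF run fs] by blast
  have "generated_alg scale (set (s n)) \<subseteq> A"
    by (rule hull_minimal) (use fs A in auto)
  moreover have "A \<subseteq> generated_alg scale (set (s n))"
    unfolding gen[symmetric] using muvak_run_generators[OF run assms(2)] by (intro hull_mono) blast
  ultimately have gen': "generated_alg scale (set (s n)) = A" by blast
  show ?thesis
  proof (rule muvak_basis_if_filt_max[OF gen'])
    fix f \<delta> assume f: "f \<in> Agr \<delta>" "f \<noteq> 0"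
    then obtain d where "filt scale vs (set (s n)) d f"
      using filt_exists[OF gen'] Agr_subset by blast
    with f show "filt scale vs (set (s n)) (\<lambda>n. (vs ! n) f) f"
      by (rule filt_max_if_tests_pass[OF stop])
  qed
qed

end

theorem proposition3p21:
  fixes scale :: "'k::field \<Rightarrow> 'b::idom \<Rightarrow> 'b"
    and A :: "'b set"
    and Agr :: "'d::ab_group_add \<Rightarrow> 'b set"
    and vs :: "('b \<Rightarrow> int) list"
    and fs :: "'b list"
  assumes "comm_algebra scale"
    and "fin_gen_alg scale (UNIV :: 'b set)"
    and "fin_gen_alg scale A"
    and "\<exists>D :: 'd set. finite D \<and> group_closure D = UNIV"
    and "graded_alg scale A Agr"
    and "\<forall>v\<in>set vs. valuation scale v"
    and "\<forall>f\<in>set fs. f \<noteq> 0 \<and> f \<in> A \<and> homogeneous_elem Agr f"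
    and "generated_alg scale (set fs) = A"
  shows "\<forall>s. muvak_run scale Agr vs fs s \<longrightarrow>
    (terminates scale Agr vs s \<longleftrightarrow> (\<exists>G. finite G \<and> muvak_basis scale A Agr vs G)) \<and>
    (terminates scale Agr vs s \<longrightarrow>
       finite (run_output scale Agr vs s) \<and> muvak_basis scale A Agr vs (run_output scale Agr vs s))"
proof (intro allI impI)
  fix s assume run: "muvak_run scale Agr vs fs s"
  interpret comm_algebra scale by (rule assms(1))
  interpret muvak_setting scale A Agr vs
    by unfold_locales (use assms(5,6) in auto)
  have fs: "generators scale A Agr vs fs"
    by unfold_locales (use assms(7) in auto)
  have "subalg scale A" using assms(3) by (simp add: fin_gen_alg_def)
  note basis = muvak_basis_if_terminates[OF run fs assms(8) this]
  have result: "finite (run_output scale Agr vs s) \<and> muvak_basis scale A Agr vs (run_output scale Agr vs s)"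
    if "terminates scale Agr vs s"
  proof -
    have "\<not> loop_condition scale Agr vs (s (LEAST n. \<not> loop_condition scale Agr vs (s n)))"
      using that unfolding terminates_def by (rule LeastI_ex)
    then show ?thesis
      unfolding run_output_def by (intro conjI finite_set basis)
  qed
  then show "(terminates scale Agr vs s \<longleftrightarrow> (\<exists>G. finite G \<and> muvak_basis scale A Agr vs G)) \<and>
    (terminates scale Agr vs s \<longrightarrow>
       finite (run_output scale Agr vs s) \<and> muvak_basis scale A Agr vs (run_output scale Agr vs s))"
    using terminates_if_finite_muvak_basis[OF run fs assms(8)] result by blast
qed

end
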